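(* Let $G$ be a finite simple graph with $s$ vertices $t_1,\ldots,t_s$ and $E(G)\neq\emptyset$, and let $I_c(G)\subset S=K[t_1,\ldots,t_s]$ be its ideal of covers. The following are equivalent: (a) ${\rm v}(I_c(G))=s-2$; (b) ${\rm v}(I_c(G))={\rm reg}(S/I_c(G))=\dim(S/I_c(G))=s-2$ and $G$ is a codi-graph; (c) every vertex cover of $G$ with the exchange property has exactly $s-1$ vertices; (d) ${\rm v}(I_c(H))=|V(H)|-2$ for every induced subgraph $H$ of $G$ with $E(H)\ne\emptyset$ (where $I_c(H)$ is taken in the polynomial ring on $V(H)$); (e) every induced subgraph $H$ of $G$ with $E(H)\neq\emptyset$ is connected; (f) $G$ is a complete multipartite graph.
   Context: $K$ is a field and $S$ has the standard grading. A vertex cover of $G$ is a subset of $V(G)$ meeting every edge; the ideal of covers $I_c(G)$ is generated by $\prod_{t_i\in C}t_i$ over all minimal vertex covers $C$ of $G$. A vertex cover $C$ has the exchange property if there is an edge $\{t_k,t_\ell\}$ with $t_k\in C$, $t_\ell\notin C$ and $(C\setminus\{t_k\})\cup\{t_\ell\}$ a vertex cover. For a graded ideal $I\subset S$, ${\rm v}(I)=\min\{d\ge 0: \exists f\in S_d,\ \exists\mathfrak p\in{\rm Ass}(I),\ (I\colon f)=\mathfrak p\}$. ${\rm reg}$ denotes Castelnuovo–Mumford regularity and $\dim$ Krull dimension. $G$ is a codi-graph if its complement $\overline{G}$ is disconnected. $G$ is complete multipartite if $G$ is the join $G_1*\cdots*G_k$, $k\ge2$, of pairwise vertex-disjoint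 graphs without edges (the join consists of the union of the $G_i$ together with all edges joining a vertex of $G_i$ with a vertex of $G_j$ for $i\ne j$). *)

theory Defs
  imports Main "HOL-Library.Poly_Mapping" "HOL-Library.Extended_Nat"
begin

type_synonym ('v,'k) mpoly = "('v \<Rightarrow>\<^sub>0 nat) \<Rightarrow>\<^sub>0 'k"

definition polyring :: "'v set \<Rightarrow> ('v,'k::field) mpoly set" where
  "polyring V = {f. \<forall>m \<in> Poly_Mapping.keys f. Poly_Mapping.keys m \<subseteq> V}"

definition var :: "'v \<Rightarrow> ('v,'k::field) mpoly" where
  "var v = Poly_Mapping.single (Poly_Mapping.single v 1) 1"

definition mon_deg :: "('v \<Rightarrow>\<^sub>0 nat) \<Rightarrow> nat" where
  "mon_deg m = (\<Sum>v\<in>Poly_Mapping.keys m. Poly_Mapping.lookup m v)"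

text \<open>f is homogeneous of degree d (standard grading); 0 is homogeneous of every degree.\<close>
definition homog :: "nat \<Rightarrow> ('v,'k::field) mpoly \<Rightarrow> bool" where
  "homog d f \<longleftrightarrow> (\<forall>m \<in> Poly_Mapping.keys f. mon_deg m = d)"

definition homog_int :: "int \<Rightarrow> ('v,'k::field) mpoly \<Rightarrow> bool" where
  "homog_int d f \<longleftrightarrow> f = 0 \<or> (d \<ge> 0 \<and> homog (nat d) f)"

definition ideal_in :: "('v,'k::field) mpoly set \<Rightarrow> ('v,'k) mpoly set \<Rightarrow> bool" where
  "ideal_in R J \<longleftrightarrow> J \<subseteq> R \<and> 0 \<in> J \<and> (\<forall>a\<in>J. \<forall>b\<in>J. a + b \<in> J)
     \<and> (\<forall>r\<in>R. \<forall>a\<in>J. r * a \<in> J)"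

definition gen_ideal :: "('v,'k::field) mpoly set \<Rightarrow> ('v,'k) mpoly set \<Rightarrow> ('v,'k) mpoly set" where
  "gen_ideal R X = \<Inter>{J. ideal_in R J \<and> X \<subseteq> J}"

definition prime_in :: "('v,'k::field) mpoly set \<Rightarrow> ('v,'k) mpoly set \<Rightarrow> bool" where
  "prime_in R P \<longleftrightarrow> ideal_in R P \<and> P \<noteq> R \<and> (\<forall>a\<in>R. \<forall>b\<in>R. a * b \<in> P \<longrightarrow> a \<in> P \<or> b \<in> P)"

definition colon :: "('v,'k::field) mpoly set \<Rightarrow> ('v,'k) mpoly set \<Rightarrow> ('v,'k) mpoly \<Rightarrow> ('v,'k) mpoly set" where
  "colon R I f = {g \<in> R. g * f \<in> I}"

definition Ass :: "('v,'k::field) mpoly set \<Rightarrow> ('v,'k) mpoly set \<Rightarrow> ('v,'k) mpoly set set" where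
  "Ass R I = {P. prime_in R P \<and> (\<exists>g\<in>R. colon R I g = P)}"

definition vnumber :: "'v set \<Rightarrow> ('v,'k::field) mpoly set \<Rightarrow> nat" where
  "vnumber V I = (LEAST d. \<exists>f \<in> polyring V. homog d f \<and>
      (\<exists>P \<in> Ass (polyring V) I. colon (polyring V) I f = P))"

text \<open>Krull dimension of R/I: supremum of lengths of chains of prime ideals of R
  containing I (these are exactly the primes of R/I).\<close>
definition krull_dim_quot :: "'v set \<Rightarrow> ('v,'k::field) mpoly set \<Rightarrow> enat" where
  "krull_dim_quot V I = Sup {enat n | n. \<exists>c :: nat \<Rightarrow> ('v,'k) mpoly set.
      (\<forall>i\<le>n. prime_in (polyring V) (c i) \<and> I \<subseteq> c i) \<and> (\<forall>i<n. c i \<subset> c (Suc i))}"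

definition fvec :: "('v,'k::field) mpoly set \<Rightarrow> nat \<Rightarrow> (nat \<Rightarrow> ('v,'k) mpoly) set" where
  "fvec R m = {u. (\<forall>j<m. u j \<in> R) \<and> (\<forall>j\<ge>m. u j = 0)}"

text \<open>Apply the matrix phi i (rows indexed by basis of F_(i-1), columns by basis of F_i).\<close>
definition app_mat :: "(nat \<Rightarrow> nat) \<Rightarrow> (nat \<Rightarrow> nat \<Rightarrow> nat \<Rightarrow> ('v,'k::field) mpoly)
    \<Rightarrow> nat \<Rightarrow> (nat \<Rightarrow> ('v,'k) mpoly) \<Rightarrow> nat \<Rightarrow> ('v,'k) mpoly" where
  "app_mat b \<phi> i u = (\<lambda>k. if k < b (i - 1) then (\<Sum>j<b i. \<phi> i k j * u j) else 0)"

text \<open>A finite graded free resolution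
  0 -> F_n -> ... -> F_1 -> F_0 = R -> R/I -> 0,
  with F_i = direct sum over j < b i of R(-a i j), differentials given by matrices phi i
  whose (k,j) entry is homogeneous of degree a i j - a (i-1) k.\<close>
definition graded_free_res ::
  "'v set \<Rightarrow> ('v,'k::field) mpoly set \<Rightarrow> nat \<Rightarrow> (nat \<Rightarrow> nat) \<Rightarrow> (nat \<Rightarrow> nat \<Rightarrow> int)
    \<Rightarrow> (nat \<Rightarrow> nat \<Rightarrow> nat \<Rightarrow> ('v,'k) mpoly) \<Rightarrow> bool" where
  "graded_free_res V I n b a \<phi> \<longleftrightarrow>
     (let R = polyring V in
       n \<ge> 1 \<and> b 0 = 1 \<and> a 0 0 = 0 \<and>
       (\<forall>i\<in>{1..n}. \<forall>k<b (i - 1). \<forall>j<b i. \<phi> i k j \<in> R \<and> homog_int (a i j - a (i - 1) k) (\<phi> i k j)) \<and>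
       {app_mat b \<phi> 1 u 0 | u. u \<in> fvec R (b 1)} = I \<and>
       (\<forall>i\<in>{1..<n}. {u \<in> fvec R (b i). app_mat b \<phi> i u = (\<lambda>_. 0)}
                       = app_mat b \<phi> (Suc i) ` fvec R (b (Suc i))) \<and>
       {u \<in> fvec R (b n). app_mat b \<phi> n u = (\<lambda>_. 0)} = {\<lambda>_. 0})"

text \<open>reg(R/I) = max_{i,j} (a_ij - i) for the minimal graded free resolution; since every
  graded free resolution contains the minimal one as a direct summand, this is the minimum of
  that quantity over all finite graded free resolutions.\<close>
definition reg_quot :: "'v set \<Rightarrow> ('v,'k::field) mpoly set \<Rightarrow> int" where
  "reg_quot V I = Inf {r. \<exists>n b a \<phi>. graded_free_res V I n b a \<phi> \<and>
       (\<forall>i\<le>n. \<forall>j<b i. a i j - int i \<le> r)}"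

definition simple_graph :: "'v set \<Rightarrow> 'v set set \<Rightarrow> bool" where
  "simple_graph V E \<longleftrightarrow> finite V \<and> (\<forall>e\<in>E. \<exists>x y. x \<noteq> y \<and> x \<in> V \<and> y \<in> V \<and> e = {x, y})"

definition vertex_cover :: "'v set \<Rightarrow> 'v set set \<Rightarrow> 'v set \<Rightarrow> bool" where
  "vertex_cover V E C \<longleftrightarrow> C \<subseteq> V \<and> (\<forall>e\<in>E. e \<inter> C \<noteq> {})"

definition min_vertex_cover :: "'v set \<Rightarrow> 'v set set \<Rightarrow> 'v set \<Rightarrow> bool" where
  "min_vertex_cover V E C \<longleftrightarrow> vertex_cover V E C \<and> (\<forall>D. D \<subset> C \<longrightarrow> \<not> vertex_cover V E D)"

definition cover_ideal :: "'v set \<Rightarrow> 'v set set \<Rightarrow> ('v,'k::field) mpoly set" where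
  "cover_ideal V E = gen_ideal (polyring V) {(\<Prod>v\<in>C. var v) | C. min_vertex_cover V E C}"

definition exchange_property :: "'v set \<Rightarrow> 'v set set \<Rightarrow> 'v set \<Rightarrow> bool" where
  "exchange_property V E C \<longleftrightarrow> (\<exists>k l. {k, l} \<in> E \<and> k \<in> C \<and> l \<notin> C \<and>
      vertex_cover V E ((C - {k}) \<union> {l}))"

definition induced_edges :: "'v set set \<Rightarrow> 'v set \<Rightarrow> 'v set set" where
  "induced_edges E U = {e \<in> E. e \<subseteq> U}"

definition graph_connected :: "'v set \<Rightarrow> 'v set set \<Rightarrow> bool" where
  "graph_connected V E \<longleftrightarrow> V \<noteq> {} \<and>
     (\<forall>x\<in>V. \<forall>y\<in>V. (\<lambda>a b. {a, b} \<in> E \<and> a \<in> V \<and> b \<in> V)\<^sup>*\<^sup>* x y)"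

definition complement_edges :: "'v set \<Rightarrow> 'v set set \<Rightarrow> 'v set set" where
  "complement_edges V E = {{x, y} | x y. x \<in> V \<and> y \<in> V \<and> x \<noteq> y \<and> {x, y} \<notin> E}"

definition codi_graph :: "'v set \<Rightarrow> 'v set set \<Rightarrow> bool" where
  "codi_graph V E \<longleftrightarrow> \<not> graph_connected V (complement_edges V E)"

definition complete_multipartite :: "'v set \<Rightarrow> 'v set set \<Rightarrow> bool" where
  "complete_multipartite V E \<longleftrightarrow> (\<exists>P. \<Union>P = V \<and> {} \<notin> P \<and>
      (\<forall>A\<in>P. \<forall>B\<in>P. A \<noteq> B \<longrightarrow> A \<inter> B = {}) \<and> card P \<ge> 2 \<and>
      E = {{x, y} | x y. \<exists>A\<in>P. \<exists>B\<in>P. A \<noteq> B \<and> x \<in> A \<and> y \<in> B})"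

end

theory Submission
  imports Defs "HOL-Library.FuncSet"
begin

text \<open>
  A polynomial lies in the ideal of covers iff the support of each of its monomials is a vertex
  cover. Hence a colon ideal \<open>(I\<^sub>c(G) : f)\<close> is prime only if some monomial of \<open>f\<close> has support \<open>W\<close> such
  that both \<open>W \<union> {k}\<close> and \<open>W \<union> {l}\<close> are covers for an edge \<open>{k, l}\<close> disjoint from \<open>W\<close>, and conversely
  such a \<open>W\<close> gives \<open>(I\<^sub>c(G) : x\<^sub>W) = (x\<^sub>k, x\<^sub>l)\<close>. So the v-number is the least \<open>|C| - 1\<close> over covers \<open>C\<close>
  with the exchange property, and it is \<open>s - 2\<close> iff non-adjacency is transitive; each of the
  combinatorial conditions is equivalent to this transitivity as well.

  A prime containing \<open>I\<^sub>c(G)\<close> contains both variables of some edge, so the dimension is \<open>s - 2\<close> because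
  chains of primes in a polynomial ring in \<open>n\<close> variables have length at most \<open>n\<close>: by counting
  monomials, any \<open>n + 1\<close> polynomials satisfy an algebraic relation.

  For a complete multipartite graph with parts \<open>P\<^sub>i\<close> the generators are the products over \<open>V - P\<^sub>i\<close>, and
  their syzygies are freely generated in degree \<open>s\<close>. This gives a resolution of length two, and a
  comparison argument shows that no other resolution can avoid a generator of degree at least \<open>s\<close> in
  homological degree two.
\<close>

abbreviation supp :: "('a \<Rightarrow>\<^sub>0 'b::zero) \<Rightarrow> 'a set" where
  "supp \<equiv> Poly_Mapping.keys"

abbreviation coeff :: "('a \<Rightarrow>\<^sub>0 'b::zero) \<Rightarrow> 'a \<Rightarrow> 'b" where
  "coeff \<equiv> Poly_Mapping.lookup"

abbreviation single :: "'a \<Rightarrow> 'b \<Rightarrow> ('a \<Rightarrow>\<^sub>0 'b::zero)" where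
  "single \<equiv> Poly_Mapping.single"

section \<open>Terms of polynomials\<close>

lemma sum_of_terms:
  fixes f :: "'a \<Rightarrow>\<^sub>0 'b::comm_monoid_add"
  shows "f = (\<Sum>m\<in>supp f. single m (coeff f m))"
  by (rule poly_mapping_eqI)
     (auto simp: lookup_sum lookup_single when_def sum.delta' in_keys_iff)

lemma supp_sum_subset:
  fixes f :: "'i \<Rightarrow> ('a \<Rightarrow>\<^sub>0 'b::comm_monoid_add)"
  shows "supp (sum f I) \<subseteq> (\<Union>i\<in>I. supp (f i))"
proof
  fix m assume "m \<in> supp (sum f I)"
  then have "(\<Sum>i\<in>I. coeff (f i) m) \<noteq> 0" by (simp add: in_keys_iff lookup_sum)
  then obtain i where "i \<in> I" "coeff (f i) m \<noteq> 0" by (meson sum.neutral)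
  then show "m \<in> (\<Union>i\<in>I. supp (f i))" by (auto simp: in_keys_iff)
qed

lemma coeff_mult_finite_sum:
  fixes f g :: "'m::comm_monoid_add \<Rightarrow>\<^sub>0 'k::comm_semiring_1"
  shows "coeff (f * g) k = (\<Sum>a\<in>supp f. \<Sum>b\<in>supp g. (coeff f a * coeff g b when a + b = k))"
proof -
  have "f * g = (\<Sum>a\<in>supp f. single a (coeff f a)) * (\<Sum>b\<in>supp g. single b (coeff g b))"
    using sum_of_terms[of f] sum_of_terms[of g] by simp
  also have "\<dots> = (\<Sum>a\<in>supp f. \<Sum>b\<in>supp g. single (a + b) (coeff f a * coeff g b))"
    by (simp add: sum_product mult_single)
  finally show ?thesis by (simp add: lookup_sum lookup_single)
qed

text \<open>Replaces the comparison of leading terms: when only one pair of terms produces the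
  exponent, the convolution sum has a single surviving summand.\<close>

lemma coeff_mult_unique:
  fixes f g :: "'m::comm_monoid_add \<Rightarrow>\<^sub>0 'k::comm_semiring_1"
  assumes "m1 \<in> supp f" "m2 \<in> supp g"
    and "\<And>a b. a \<in> supp f \<Longrightarrow> b \<in> supp g \<Longrightarrow> a + b = m1 + m2 \<Longrightarrow> a = m1 \<and> b = m2"
  shows "coeff (f * g) (m1 + m2) = coeff f m1 * coeff g m2"
proof -
  have "coeff (f * g) (m1 + m2) =
      (\<Sum>a\<in>supp f. \<Sum>b\<in>supp g. if a = m1 then if b = m2 then coeff f a * coeff g b else 0 else 0)"
    unfolding coeff_mult_finite_sum using assms(3)
    by (intro sum.cong refl) (auto simp: when_def)
  also have "\<dots> = (\<Sum>a\<in>supp f. if a = m1 then coeff f a * coeff g m2 else 0)"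
    using assms(2) by (intro sum.cong refl) (auto simp: sum.delta)
  also have "\<dots> = coeff f m1 * coeff g m2"
    using assms(1) by (simp add: sum.delta)
  finally show ?thesis .
qed

lemma coeff_single_mult:
  fixes g :: "'m::cancel_comm_monoid_add \<Rightarrow>\<^sub>0 'k::comm_semiring_1"
  shows "coeff (single a c * g) (a + m) = c * coeff g m"
  by (simp add: lookup_mult lookup_single when_mult)

lemma supp_single_mult:
  fixes g :: "'m::cancel_comm_monoid_add \<Rightarrow>\<^sub>0 'k::comm_semiring_1"
  shows "supp (single a 1 * g) = (+) a ` supp g"
proof
  show "supp (single a 1 * g) \<subseteq> (+) a ` supp g"
    using keys_mult[of "single a 1" g] by auto
  show "(+) a ` supp g \<subseteq> supp (single a 1 * g)"
    by (auto simp: in_keys_iff coeff_single_mult)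
qed

lemma single_mult_cancel:
  fixes f g :: "'m::cancel_comm_monoid_add \<Rightarrow>\<^sub>0 'k::comm_semiring_1"
  assumes "single a 1 * f = single a 1 * g"
  shows "f = g"
  by (metis assms coeff_single_mult mult_1 poly_mapping_eqI)

text \<open>Serves three purposes according to \<open>Q\<close>: setting some variables to zero,
  taking a homogeneous component, and sorting terms by a generator that divides them.\<close>

lift_definition restrict_terms :: "('m \<Rightarrow> bool) \<Rightarrow> ('m \<Rightarrow>\<^sub>0 'k::zero) \<Rightarrow> ('m \<Rightarrow>\<^sub>0 'k)"
  is "\<lambda>Q f m. if Q m then f m else 0"
  by (rule finite_subset) auto

lemma supp_restrict_terms: "supp (restrict_terms Q f) = {m \<in> supp f. Q m}"
  by (auto simp: in_keys_iff restrict_terms.rep_eq split: if_splits)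

lemma restrict_terms_sum:
  fixes f :: "'i \<Rightarrow> ('a \<Rightarrow>\<^sub>0 'b::comm_monoid_add)"
  shows "restrict_terms Q (sum f I) = (\<Sum>i\<in>I. restrict_terms Q (f i))"
  by (rule poly_mapping_eqI) (simp add: lookup_sum restrict_terms.rep_eq)

lemma restrict_terms_split:
  fixes f :: "'a \<Rightarrow>\<^sub>0 'b::comm_monoid_add"
  shows "f = restrict_terms Q f + restrict_terms (\<lambda>m. \<not> Q m) f"
  by (rule poly_mapping_eqI) (simp add: lookup_add restrict_terms.rep_eq)

lemma restrict_terms_id: "(\<And>m. m \<in> supp f \<Longrightarrow> Q m) \<Longrightarrow> restrict_terms Q f = f"
  by (rule poly_mapping_eqI) (metis restrict_terms.rep_eq not_in_keys_iff_lookup_eq_zero)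

lemma restrict_terms_add:
  fixes f g :: "'a \<Rightarrow>\<^sub>0 'b::comm_monoid_add"
  shows "restrict_terms Q (f + g) = restrict_terms Q f + restrict_terms Q g"
  by (rule poly_mapping_eqI) (simp add: lookup_add restrict_terms.rep_eq)

text \<open>The condition makes the monomials outside \<open>Q\<close> absorbing under
  multiplication, so any product that involves a dropped term is itself dropped.\<close>

lemma restrict_terms_mult:
  fixes f g :: "'m::comm_monoid_add \<Rightarrow>\<^sub>0 'k::comm_semiring_1"
  assumes Q: "\<And>a b. Q (a + b) \<longleftrightarrow> Q a \<and> Q b"
  shows "restrict_terms Q (f * g) = restrict_terms Q f * restrict_terms Q g"
proof -
  let ?N = "\<lambda>m. \<not> Q m"
  let ?f = "restrict_terms Q f" and ?g = "restrict_terms Q g"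
  let ?f' = "restrict_terms ?N f" and ?g' = "restrict_terms ?N g"
  have "restrict_terms Q (?f * ?g) = ?f * ?g"
    by (rule restrict_terms_id) (use keys_mult[of ?f ?g] Q in \<open>force simp: supp_restrict_terms\<close>)
  moreover have "restrict_terms Q (?f' * h) = 0" for h
    using keys_mult[of ?f' h] Q
    by (subst keys_eq_empty[symmetric]) (force simp: supp_restrict_terms)
  moreover have "restrict_terms Q (?f * ?g') = 0"
    using keys_mult[of ?f ?g'] Q
    by (subst keys_eq_empty[symmetric]) (force simp: supp_restrict_terms)
  moreover have "f * g = ?f * ?g + ?f * ?g' + ?f' * g"
  proof -
    have "f * g = (?f + ?f') * g" using restrict_terms_split[of f Q] by simp
    also have "\<dots> = ?f * (?g + ?g') + ?f' * g"
      using restrict_terms_split[of g Q] by (simp add: distrib_right)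
    finally show ?thesis by (simp add: distrib_left)
  qed
  ultimately show ?thesis by (simp add: restrict_terms_add)
qed

text \<open>With \<open>Q\<close> a condition on degrees, this turns a homogeneous component of a
  multiple of a monomial into a component of the cofactor.\<close>

lemma restrict_terms_single_mult:
  fixes g :: "'m::cancel_comm_monoid_add \<Rightarrow>\<^sub>0 'k::comm_semiring_1"
  shows "restrict_terms Q (single a 1 * g) = single a 1 * restrict_terms (\<lambda>m. Q (a + m)) g"
proof (rule poly_mapping_eqI)
  fix k
  show "coeff (restrict_terms Q (single a 1 * g)) k
      = coeff (single a 1 * restrict_terms (\<lambda>m. Q (a + m)) g) k"
  proof (cases "\<exists>m. k = a + m")
    case True
    then show ?thesis by (auto simp: coeff_single_mult restrict_terms.rep_eq)
  next
    case False
    then have "k \<notin> supp (single a 1 * h)" for h :: "'m \<Rightarrow>\<^sub>0 'k"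
      by (auto simp: supp_single_mult)
    then show ?thesis
      by (simp add: not_in_keys_iff_lookup_eq_zero restrict_terms.rep_eq)
  qed
qed

text \<open>A leading-monomial argument that needs no order on the variables: maximise the exponents one
  variable at a time.\<close>

lemma monomial_sets_unique_sum:
  fixes A B :: "('v \<Rightarrow>\<^sub>0 nat) set"
  assumes "finite U" "finite A" "finite B" "A \<noteq> {}" "B \<noteq> {}"
    and "\<And>m m' v. m \<in> A \<Longrightarrow> m' \<in> A \<Longrightarrow> v \<notin> U \<Longrightarrow> coeff m v = coeff m' v"
    and "\<And>m m' v. m \<in> B \<Longrightarrow> m' \<in> B \<Longrightarrow> v \<notin> U \<Longrightarrow> coeff m v = coeff m' v"
  shows "\<exists>m1\<in>A. \<exists>m2\<in>B. \<forall>a\<in>A. \<forall>b\<in>B. a + b = m1 + m2 \<longrightarrow> a = m1 \<and> b = m2"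
  using assms
proof (induction U arbitrary: A B rule: finite_induct)
  case empty
  then obtain m1 m2 where "m1 \<in> A" "m2 \<in> B" by blast
  moreover from empty have "a = m1" if "a \<in> A" for a
    using that \<open>m1 \<in> A\<close> by (intro poly_mapping_eqI) blast
  moreover from empty have "b = m2" if "b \<in> B" for b
    using that \<open>m2 \<in> B\<close> by (intro poly_mapping_eqI) blast
  ultimately show ?case by blast
next
  case (insert v U)
  \<comment> \<open>\<open>top C\<close> is the face of \<open>C\<close> on which the exponent of
    \<open>v\<close> is largest. That exponent is constant there, so \<open>v\<close> leaves the set
    of varying variables and the induction hypothesis applies to the faces.\<close>
  define top where "top C = {m \<in> C. coeff m v = Max ((\<lambda>m. coeff m v) ` C)}"
    for C :: "('v \<Rightarrow>\<^sub>0 nat) set"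
  have ne: "top C \<noteq> {}" if "finite C" "C \<noteq> {}" for C
  proof -
    have "Max ((\<lambda>m. coeff m v) ` C) \<in> (\<lambda>m. coeff m v) ` C" using that by (intro Max_in) auto
    then obtain m where "m \<in> C" "coeff m v = Max ((\<lambda>m. coeff m v) ` C)" by force
    then show ?thesis unfolding top_def by blast
  qed
  have le: "coeff m v \<le> coeff m' v" if "finite C" "m \<in> C" "m' \<in> top C" for C m m'
    using that by (simp add: top_def)
  have agree: "coeff m w = coeff m' w" if "m \<in> top A" "m' \<in> top A" "w \<notin> U" for m m' w
    using that insert.prems(5)[of m m' w] by (cases "w = v") (auto simp: top_def)
  have agree': "coeff m w = coeff m' w" if "m \<in> top B" "m' \<in> top B" "w \<notin> U" for m m' w
    using that insert.prems(6)[of m m' w] by (cases "w = v") (auto simp: top_def)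
  have "\<exists>m1\<in>top A. \<exists>m2\<in>top B. \<forall>a\<in>top A. \<forall>b\<in>top B. a + b = m1 + m2 \<longrightarrow> a = m1 \<and> b = m2"
  proof (rule insert.IH)
    show "finite (top A)" "finite (top B)" using insert.prems(1,2) by (simp_all add: top_def)
    show "top A \<noteq> {}" "top B \<noteq> {}" using insert.prems(1-4) ne by blast+
  qed (fact agree, fact agree')
  then obtain m1 m2 where m: "m1 \<in> top A" "m2 \<in> top B"
    "\<And>a b. a \<in> top A \<Longrightarrow> b \<in> top B \<Longrightarrow> a + b = m1 + m2 \<Longrightarrow> a = m1 \<and> b = m2"
    by blast
  \<comment> \<open>Each exponent of \<open>v\<close> is bounded by the maximum on its side, so
    equality of the sums forces both maxima and puts \<open>a\<close> and \<open>b\<close> into the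
    faces.\<close>
  have "a = m1 \<and> b = m2" if ab: "a \<in> A" "b \<in> B" "a + b = m1 + m2" for a b
  proof -
    have "coeff a v \<le> coeff m1 v" "coeff b v \<le> coeff m2 v"
      using le insert.prems(1,2) ab m by blast+
    moreover have "coeff a v + coeff b v = coeff m1 v + coeff m2 v"
      using ab(3) by (metis lookup_add)
    ultimately have "coeff a v = coeff m1 v" "coeff b v = coeff m2 v" by linarith+
    then have "a \<in> top A" "b \<in> top B" using ab m by (auto simp: top_def)
    then show ?thesis using m(3) ab(3) by blast
  qed
  moreover have "m1 \<in> A" "m2 \<in> B" using m by (auto simp: top_def)
  ultimately show ?case by blast
qed

text \<open>Only finitely many variables occur in \<open>f\<close> and \<open>g\<close>, so some
  product of a term of \<open>f\<close> with a term of \<open>g\<close> is met by no other pair and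
  cannot cancel.\<close>

lemma mpoly_mult_nonzero:
  fixes f g :: "('v, 'k::field) mpoly"
  assumes "f \<noteq> 0" "g \<noteq> 0"
  shows "f * g \<noteq> 0"
proof -
  define U where "U = (\<Union>m\<in>supp f \<union> supp g. supp m)"
  have z: "coeff m v = 0" if "m \<in> supp f \<union> supp g" "v \<notin> U" for m v
    using that by (auto simp: U_def not_in_keys_iff_lookup_eq_zero[symmetric])
  have "\<exists>m1\<in>supp f. \<exists>m2\<in>supp g. \<forall>a\<in>supp f. \<forall>b\<in>supp g. a + b = m1 + m2 \<longrightarrow> a = m1 \<and> b = m2"
    by (rule monomial_sets_unique_sum[of U]) (use assms z in \<open>auto simp: U_def\<close>)
  then obtain m1 m2 where "m1 \<in> supp f" "m2 \<in> supp g" "coeff (f * g) (m1 + m2) = coeff f m1 * coeff g m2"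
    using coeff_mult_unique by blast
  then have "coeff (f * g) (m1 + m2) \<noteq> 0" by (simp add: in_keys_iff)
  then show ?thesis by (metis lookup_zero)
qed

section \<open>Monomials and polynomial rings\<close>

lemma supp_monomial_add: "supp (m + m') = supp m \<union> supp m'"
  for m m' :: "'v \<Rightarrow>\<^sub>0 nat"
  by (auto simp: in_keys_iff lookup_add)

lemma supp_monomial_minus: "supp (m - m') \<subseteq> supp m"
  for m m' :: "'v \<Rightarrow>\<^sub>0 nat"
  by (auto simp: in_keys_iff lookup_minus)

lemma mon_deg_eq_sum:
  assumes "finite S" "supp m \<subseteq> S"
  shows "mon_deg m = (\<Sum>v\<in>S. coeff m v)"
  unfolding mon_deg_def using assms by (intro sum.mono_neutral_left) (auto simp: in_keys_iff)

lemma mon_deg_add: "mon_deg (m + m') = mon_deg m + mon_deg m'"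
proof -
  have "mon_deg n = (\<Sum>v\<in>supp m \<union> supp m'. coeff n v)" if "n \<in> {m, m', m + m'}" for n
    using that by (intro mon_deg_eq_sum) (auto simp: supp_monomial_add)
  then show ?thesis by (simp add: lookup_add sum.distrib)
qed

lemma card_supp_le_mon_deg: "card (supp m) \<le> mon_deg m"
proof -
  have "(\<Sum>v\<in>supp m. 1) \<le> (\<Sum>v\<in>supp m. coeff m v)"
    by (intro sum_mono) (auto simp: in_keys_iff)
  then show ?thesis by (simp add: mon_deg_def)
qed

lemma coeff_le_mon_deg: "coeff m v \<le> mon_deg m"
proof (cases "v \<in> supp m")
  case True
  then show ?thesis unfolding mon_deg_def by (intro member_le_sum) auto
qed (simp add: not_in_keys_iff_lookup_eq_zero)

definition sqfree_mon :: "'v set \<Rightarrow> ('v \<Rightarrow>\<^sub>0 nat)" where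
  "sqfree_mon A = (\<Sum>v\<in>A. single v 1)"

abbreviation xprod :: "'v set \<Rightarrow> ('v, 'k::field) mpoly" where
  "xprod A \<equiv> single (sqfree_mon A) 1"

lemma coeff_sqfree_mon: "finite A \<Longrightarrow> coeff (sqfree_mon A) v = (if v \<in> A then 1 else 0)"
  by (simp add: sqfree_mon_def lookup_sum lookup_single when_def)

lemma supp_sqfree_mon: "finite A \<Longrightarrow> supp (sqfree_mon A) = A"
  by (auto simp: in_keys_iff coeff_sqfree_mon split: if_splits)

lemma mon_deg_sqfree_mon: "finite A \<Longrightarrow> mon_deg (sqfree_mon A) = card A"
  by (simp add: mon_deg_def supp_sqfree_mon coeff_sqfree_mon)

lemma prod_var_eq_xprod: "(\<Prod>v\<in>A. var v) = xprod A"
  by (induction A rule: infinite_finite_induct)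
     (simp_all add: sqfree_mon_def var_def mult_single single_one)

lemma xprod_mult_disjoint:
  "finite A \<Longrightarrow> finite B \<Longrightarrow> A \<inter> B = {} \<Longrightarrow> xprod A * xprod B = xprod (A \<union> B)"
  by (simp add: mult_single sqfree_mon_def sum.union_disjoint)

text \<open>Subtraction of exponents is truncated; it is exact here because every variable of
  \<open>A\<close> has exponent at least one in \<open>m\<close>.\<close>

lemma monomial_eq_sqfree_mon_add:
  assumes "finite A" "A \<subseteq> supp m"
  shows "m = sqfree_mon A + (m - sqfree_mon A)"
proof (rule poly_mapping_eqI)
  fix v
  have "v \<in> A \<Longrightarrow> coeff m v \<ge> 1" using assms by (auto simp: in_keys_iff Suc_le_eq)
  then show "coeff m v = coeff (sqfree_mon A + (m - sqfree_mon A)) v"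
    using assms(1) by (simp add: lookup_add lookup_minus coeff_sqfree_mon)
qed

lemma polyring_add: "f \<in> polyring V \<Longrightarrow> g \<in> polyring V \<Longrightarrow> f + g \<in> polyring V"
  using keys_add[of f g] by (auto simp: polyring_def)

lemma polyring_mult: "f \<in> polyring V \<Longrightarrow> g \<in> polyring V \<Longrightarrow> f * g \<in> polyring V"
  using keys_mult[of f g] by (fastforce simp: polyring_def supp_monomial_add)

lemma polyring_uminus: "f \<in> polyring V \<Longrightarrow> - f \<in> polyring V"
  by (simp add: polyring_def)

lemma polyring_diff: "f \<in> polyring V \<Longrightarrow> g \<in> polyring V \<Longrightarrow> f - g \<in> polyring V"
  using polyring_add[of f V "- g"] by (simp add: polyring_uminus)

lemma polyring_single: "supp m \<subseteq> V \<Longrightarrow> single m c \<in> polyring V"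
  by (auto simp: polyring_def)

lemma polyring_0: "0 \<in> polyring V"
  by (simp add: polyring_def)

lemma polyring_1: "1 \<in> polyring V"
  by (simp add: polyring_def)

lemma polyring_xprod: "finite A \<Longrightarrow> A \<subseteq> V \<Longrightarrow> xprod A \<in> polyring V"
  by (simp add: polyring_single supp_sqfree_mon)

lemma polyring_var: "v \<in> V \<Longrightarrow> var v \<in> polyring V"
  by (simp add: var_def polyring_single)

lemma polyring_sum: "(\<And>i. i \<in> I \<Longrightarrow> f i \<in> polyring V) \<Longrightarrow> sum f I \<in> polyring V"
  by (induction I rule: infinite_finite_induct) (auto simp: polyring_0 polyring_add)

lemma polyring_power: "f \<in> polyring V \<Longrightarrow> f ^ n \<in> polyring V"
  by (induction n) (auto simp: polyring_1 polyring_mult)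

lemma polyring_restrict_terms: "f \<in> polyring V \<Longrightarrow> restrict_terms Q f \<in> polyring V"
  by (auto simp: polyring_def supp_restrict_terms)

lemma polyring_mono: "U \<subseteq> V \<Longrightarrow> polyring U \<subseteq> polyring V"
  by (auto simp: polyring_def)

lemmas polyring_intros = polyring_add polyring_diff polyring_mult polyring_uminus polyring_0 polyring_1
  polyring_sum polyring_power polyring_restrict_terms

text \<open>Divisibility by a monomial is checked term by term, and the quotient is the sum of the
  divided terms.\<close>

lemma xprod_dvd:
  fixes f :: "('v, 'k::field) mpoly"
  assumes "f \<in> polyring V" "finite A" "\<And>m. m \<in> supp f \<Longrightarrow> A \<subseteq> supp m"
  obtains g where "g \<in> polyring V" "f = xprod A * g"
proof
  let ?g = "\<Sum>m\<in>supp f. single (m - sqfree_mon A) (coeff f m)"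
  show "?g \<in> polyring V"
    using assms(1) supp_monomial_minus
    by (intro polyring_sum polyring_single) (fastforce simp: polyring_def)
  have "xprod A * ?g = (\<Sum>m\<in>supp f. single m (coeff f m))"
    using monomial_eq_sqfree_mon_add[OF assms(2) assms(3)]
    by (simp add: sum_distrib_left mult_single)
  then show "f = xprod A * ?g" using sum_of_terms[of f] by simp
qed

lemma supp_xprod_mult_superset:
  assumes "finite A" "m \<in> supp (xprod A * g)"
  shows "A \<subseteq> supp m"
  using assms by (auto simp: supp_single_mult supp_monomial_add supp_sqfree_mon)

section \<open>Ideals of polynomial rings and primes generated by variables\<close>

lemma ideal_in_sum:
  assumes "ideal_in R J" "\<And>i. i \<in> I \<Longrightarrow> f i \<in> J"
  shows "sum f I \<in> J"
  using assms(2)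
proof (induction I rule: infinite_finite_induct)
  case (insert x F)
  then have "f x \<in> J" "sum f F \<in> J" by auto
  with insert show ?case using assms(1) by (simp add: ideal_in_def)
qed (use assms(1) in \<open>auto simp: ideal_in_def\<close>)

text \<open>The ideal generated by the variables in \<open>U \<inter> V\<close>, described through
  the terms so that membership requires no cofactors.\<close>

definition var_ideal :: "'v set \<Rightarrow> 'v set \<Rightarrow> ('v, 'k::field) mpoly set" where
  "var_ideal V U = {f \<in> polyring V. \<forall>m\<in>supp f. supp m \<inter> U \<noteq> {}}"

text \<open>Setting the variables of \<open>U\<close> to zero respects products and lands in a
  domain; this ideal is the kernel.\<close>

lemma prime_var_ideal: "prime_in (polyring V) (var_ideal V U :: ('v, 'k::field) mpoly set)"
proof -
  let ?R = "polyring V :: ('v, 'k) mpoly set" and ?q = "var_ideal V U :: ('v, 'k) mpoly set"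
  let ?Q = "\<lambda>m :: 'v \<Rightarrow>\<^sub>0 nat. supp m \<inter> U = {}"
  have q_iff: "f \<in> ?q \<longleftrightarrow> restrict_terms ?Q f = 0" if "f \<in> ?R" for f
    using that by (subst keys_eq_empty[symmetric]) (auto simp: var_ideal_def supp_restrict_terms)
  have mult: "restrict_terms ?Q (f * g) = restrict_terms ?Q f * restrict_terms ?Q g"
    for f g :: "('v, 'k) mpoly"
    by (rule restrict_terms_mult) (auto simp: supp_monomial_add)
  have "?q \<subseteq> ?R" by (auto simp: var_ideal_def)
  moreover have "0 \<in> ?q" by (simp add: var_ideal_def polyring_0)
  moreover have "a + b \<in> ?q" if "a \<in> ?q" "b \<in> ?q" for a b
    using that keys_add[of a b] by (auto simp: var_ideal_def polyring_add)
  moreover have "r * a \<in> ?q" if "r \<in> ?R" "a \<in> ?q" for r a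
    using that q_iff[of a] q_iff[of "r * a"] mult by (auto simp: var_ideal_def polyring_mult)
  ultimately have "ideal_in ?R ?q" unfolding ideal_in_def by blast
  moreover have "1 \<in> ?R - ?q" by (simp add: var_ideal_def polyring_1)
  moreover have "a \<in> ?q \<or> b \<in> ?q" if "a \<in> ?R" "b \<in> ?R" "a * b \<in> ?q" for a b
    using that q_iff mult mpoly_mult_nonzero polyring_mult by metis
  ultimately show ?thesis unfolding prime_in_def by blast
qed

lemma prime_in_one:
  assumes "prime_in (polyring V) P"
  shows "1 \<notin> P"
  using assms unfolding prime_in_def ideal_in_def by (metis mult_1_right subsetI subset_antisym)

lemma prime_in_xprod:
  assumes P: "prime_in (polyring V) P" and "finite A" "A \<subseteq> V" "xprod A \<in> P"
  shows "\<exists>v\<in>A. var v \<in> P"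
  using assms(2-)
proof (induction A rule: finite_induct)
  case empty
  then show ?case using prime_in_one[OF P] by (simp add: sqfree_mon_def)
next
  case (insert v A)
  have "var v * xprod A \<in> P"
    using insert by (simp add: prod_var_eq_xprod[symmetric])
  moreover have "var v \<in> polyring V" "xprod A \<in> polyring V"
    using insert by (simp_all add: polyring_var polyring_xprod)
  ultimately have "var v \<in> P \<or> xprod A \<in> P"
    using P unfolding prime_in_def by blast
  then show ?case using insert by blast
qed

section \<open>Ideals of covers and the v-number\<close>

lemma simple_graph_edgeE:
  assumes "simple_graph V E" "e \<in> E"
  obtains k l where "e = {k, l}" "k \<noteq> l" "k \<in> V" "l \<in> V"
  using assms unfolding simple_graph_def by blast

lemma simple_graph_edge_in:
  assumes "simple_graph V E" "{k, l} \<in> E"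
  shows "k \<in> V" "l \<in> V" "k \<noteq> l"
  using simple_graph_edgeE[OF assms] by (auto simp: doubleton_eq_iff)

lemma vertex_cover_superset:
  "vertex_cover V E C \<Longrightarrow> C \<subseteq> D \<Longrightarrow> D \<subseteq> V \<Longrightarrow> vertex_cover V E D"
  unfolding vertex_cover_def by blast

lemma vertex_cover_contains_minimal:
  assumes "finite C" "vertex_cover V E C"
  obtains D where "min_vertex_cover V E D" "D \<subseteq> C"
proof -
  let ?S = "{D. D \<subseteq> C \<and> vertex_cover V E D}"
  have "finite ?S" using assms(1) by (rule_tac finite_subset[of _ "Pow C"]) auto
  then obtain D where D: "D \<in> ?S" "\<And>D'. D' \<in> ?S \<Longrightarrow> D' \<subseteq> D \<Longrightarrow> D' = D"
    using finite_has_minimal2[of ?S C] assms(2) by (smt (verit) mem_Collect_eq order_refl)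
  then have "min_vertex_cover V E D" unfolding min_vertex_cover_def by blast
  then show ?thesis using D(1) that by blast
qed

text \<open>Both inclusions rest on one fact: a monomial in the variables of \<open>V\<close> is
  divisible by the product over some minimal cover exactly when its support is a cover.\<close>

lemma cover_ideal_eq:
  assumes "finite V"
  shows "(cover_ideal V E :: ('v, 'k::field) mpoly set)
    = {f \<in> polyring V. \<forall>m\<in>supp f. vertex_cover V E (supp m)}"
proof -
  let ?R = "polyring V :: ('v, 'k) mpoly set"
  let ?X = "{(\<Prod>v\<in>C. var v) | C. min_vertex_cover V E C} :: ('v, 'k) mpoly set"
  let ?J = "{f \<in> ?R. \<forall>m\<in>supp f. vertex_cover V E (supp m)}"
  have fin: "finite C" if "vertex_cover V E C" for C
    using that assms finite_subset by (auto simp: vertex_cover_def)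
  have J_mult: "r * a \<in> ?J" if "r \<in> ?R" "a \<in> ?J" for r a
  proof -
    have "vertex_cover V E (supp (m + m'))" if "m \<in> supp r" "m' \<in> supp a" for m m'
      by (rule vertex_cover_superset[of V E "supp m'"])
         (use that \<open>r \<in> ?R\<close> \<open>a \<in> ?J\<close> in \<open>auto simp: supp_monomial_add polyring_def\<close>)
    then show ?thesis using that keys_mult[of r a] by (auto simp: polyring_mult)
  qed
  have J_add: "a + b \<in> ?J" if "a \<in> ?J" "b \<in> ?J" for a b
    using that keys_add[of a b] by (auto simp: polyring_add)
  have "ideal_in ?R ?J"
    unfolding ideal_in_def
  proof (intro conjI ballI)
    show "0 \<in> ?J" by (simp add: polyring_0)
  qed (blast, (fact J_add J_mult)+)
  moreover have "?X \<subseteq> ?J"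
    using fin by (auto simp: prod_var_eq_xprod min_vertex_cover_def vertex_cover_def
        supp_sqfree_mon intro!: polyring_xprod)
  moreover have "f \<in> J" if J: "ideal_in ?R J" "?X \<subseteq> J" and f: "f \<in> ?J" for f J
  proof -
    \<comment> \<open>Since \<open>f\<close> is the sum of its terms, it suffices to place each term
      in \<open>J\<close>, as a multiple of the generator of a minimal cover inside its
      support.\<close>
    have "single m (coeff f m) \<in> J" if m: "m \<in> supp f" for m
    proof -
      have C: "vertex_cover V E (supp m)" using f m by blast
      then obtain D where D: "min_vertex_cover V E D" "D \<subseteq> supp m"
        using vertex_cover_contains_minimal[of "supp m"] by auto
      have finD: "finite D" using D(2) by (rule finite_subset) simp
      have "xprod D \<in> J" using J(2) D(1) by (auto simp: prod_var_eq_xprod)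
      moreover have "supp (m - sqfree_mon D) \<subseteq> V"
        using C supp_monomial_minus[of m] by (fastforce simp: vertex_cover_def)
      then have "single (m - sqfree_mon D) (coeff f m) \<in> ?R" by (rule polyring_single)
      ultimately have "single (m - sqfree_mon D) (coeff f m) * xprod D \<in> J"
        using J(1) unfolding ideal_in_def by blast
      then show ?thesis
        using monomial_eq_sqfree_mon_add[OF finD D(2)] by (simp add: mult_single add.commute)
    qed
    then show ?thesis using ideal_in_sum[OF J(1)] sum_of_terms[of f] by metis
  qed
  ultimately show ?thesis unfolding cover_ideal_def gen_ideal_def by blast
qed

text \<open>Adjoining \<open>k\<close> or \<open>l\<close> completes \<open>C - {k}\<close> to a
  cover, while without both of them the edge \<open>{k, l}\<close> stays uncovered. So a monomial
  lies in the colon ideal exactly when it involves one of these two variables.\<close>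

lemma colon_exchange_cover:
  assumes "finite V" "vertex_cover V E C" "{k, l} \<in> E" "k \<in> C" "l \<notin> C"
    and "vertex_cover V E ((C - {k}) \<union> {l})"
  shows "colon (polyring V) (cover_ideal V E) (xprod (C - {k}))
    = (var_ideal V {k, l} :: ('v, 'k::field) mpoly set)"
proof -
  have CV: "C \<subseteq> V" "finite (C - {k})"
    using assms(1,2) finite_subset by (auto simp: vertex_cover_def)
  have iff: "vertex_cover V E ((C - {k}) \<union> S) \<longleftrightarrow> S \<inter> {k, l} \<noteq> {}" if "S \<subseteq> V" for S
  proof
    assume "vertex_cover V E ((C - {k}) \<union> S)"
    then have "{k, l} \<inter> ((C - {k}) \<union> S) \<noteq> {}" using assms(3) unfolding vertex_cover_def by blast
    then show "S \<inter> {k, l} \<noteq> {}" using assms(5) by blast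
  next
    assume "S \<inter> {k, l} \<noteq> {}"
    then have "C \<subseteq> (C - {k}) \<union> S \<or> (C - {k}) \<union> {l} \<subseteq> (C - {k}) \<union> S" by blast
    then show "vertex_cover V E ((C - {k}) \<union> S)"
      using vertex_cover_superset[OF assms(2)] vertex_cover_superset[OF assms(6)] that CV by blast
  qed
  have "g * xprod (C - {k}) \<in> cover_ideal V E \<longleftrightarrow> g \<in> var_ideal V {k, l}"
    if g: "g \<in> polyring V" for g :: "('v, 'k) mpoly"
  proof -
    have "g * xprod (C - {k}) \<in> polyring V"
      using g CV by (intro polyring_mult polyring_xprod) auto
    moreover have "supp (g * xprod (C - {k})) = (+) (sqfree_mon (C - {k})) ` supp g"
      using supp_single_mult[of _ g] by (simp only: mult.commute[of g])
    ultimately show ?thesis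
      using g iff by (auto simp: cover_ideal_eq[OF assms(1)] var_ideal_def supp_monomial_add
          supp_sqfree_mon[OF CV(2)] polyring_def)
  qed
  then show ?thesis unfolding colon_def by (auto simp: var_ideal_def)
qed

text \<open>Some edge missed by a term of \<open>f\<close> has both of its variables in the colon
  ideal: otherwise choose, for each missed edge, an end whose variable lies outside. The product of
  the chosen variables multiplies \<open>f\<close> into the ideal of covers, so it lies in the prime
  although none of its factors does. The support of the missing term together with either end of
  that edge is then the required cover.\<close>

lemma colon_prime_imp_exchange_cover:
  fixes f :: "('v, 'k::field) mpoly"
  assumes G: "simple_graph V E" and f: "f \<in> polyring V" "homog d f"
    and P: "prime_in (polyring V) (colon (polyring V) (cover_ideal V E) f)"
  obtains C where "vertex_cover V E C" "exchange_property V E C" "card C - 1 \<le> d"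
proof -
  let ?P = "colon (polyring V) (cover_ideal V E) f"
  have V: "finite V" using G by (simp add: simple_graph_def)
  note I = cover_ideal_eq[OF V]
  have "\<exists>e\<in>E. (\<exists>m\<in>supp f. supp m \<inter> e = {}) \<and> (\<forall>v\<in>e. var v \<in> ?P)"
  proof (rule ccontr)
    assume "\<not> ?thesis"
    then have "\<forall>e\<in>E. \<exists>v. (\<exists>m\<in>supp f. supp m \<inter> e = {}) \<longrightarrow> v \<in> e \<and> var v \<notin> ?P" by blast
    then obtain w where w: "\<And>e. e \<in> E \<Longrightarrow> (\<exists>m\<in>supp f. supp m \<inter> e = {}) \<Longrightarrow> w e \<in> e \<and> var (w e) \<notin> ?P"
      by metis
    define A where "A = w ` {e \<in> E. \<exists>m\<in>supp f. supp m \<inter> e = {}}"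
    have "e \<subseteq> V" if "e \<in> E" for e using simple_graph_edgeE[OF G that] by blast
    then have "A \<subseteq> V" unfolding A_def using w by blast
    then have fin: "finite A" using V finite_subset by blast
    have "xprod A * f \<in> polyring V" using f \<open>A \<subseteq> V\<close> fin by (intro polyring_mult polyring_xprod)
    moreover have "vertex_cover V E (supp m)" if m: "m \<in> supp (xprod A * f)" for m
    proof -
      obtain m' where m': "m' \<in> supp f" "m = sqfree_mon A + m'"
        using m unfolding supp_single_mult by blast
      have "e \<inter> (A \<union> supp m') \<noteq> {}" if "e \<in> E" for e
        using w[OF that] m'(1) that unfolding A_def by blast
      moreover have "supp m' \<subseteq> V" using f m' by (auto simp: polyring_def)
      ultimately show ?thesis
        using \<open>A \<subseteq> V\<close> m'(2) fin by (simp add: vertex_cover_def supp_monomial_add supp_sqfree_mon)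
    qed
    ultimately have "xprod A \<in> ?P"
      using \<open>A \<subseteq> V\<close> fin by (simp add: colon_def I polyring_xprod)
    then obtain v where "v \<in> A" "var v \<in> ?P"
      using prime_in_xprod[OF P fin \<open>A \<subseteq> V\<close>] by blast
    then show False using w unfolding A_def by blast
  qed
  then obtain e m where e: "e \<in> E" "\<And>v. v \<in> e \<Longrightarrow> var v \<in> ?P" and m: "m \<in> supp f" "supp m \<inter> e = {}"
    by blast
  obtain k l where kl: "e = {k, l}" "k \<noteq> l" using simple_graph_edgeE[OF G e(1)] by blast
  \<comment> \<open>Multiplying by a variable only shifts the terms, so no cancellation hides the
    term coming from \<open>m\<close>.\<close>
  have cover: "vertex_cover V E (insert v (supp m))" if "v \<in> e" for v
  proof -
    have "var v * f \<in> cover_ideal V E" using e(2)[OF that] by (simp add: colon_def)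
    moreover have "single v 1 + m \<in> supp (var v * f)"
      using m(1) by (simp add: var_def supp_single_mult)
    ultimately have "vertex_cover V E (supp (single v 1 + m))" by (simp add: I)
    then show ?thesis by (simp add: supp_monomial_add)
  qed
  show ?thesis
  proof
    show "vertex_cover V E (insert k (supp m))" using cover kl by simp
    have "insert k (supp m) - {k} \<union> {l} = insert l (supp m)" using kl m(2) by auto
    then show "exchange_property V E (insert k (supp m))"
      unfolding exchange_property_def using e(1) kl m(2) cover[of l]
      by (intro exI[of _ k] exI[of _ l]) auto
    have "k \<notin> supp m" using m(2) kl by auto
    then have "card (insert k (supp m)) - 1 = card (supp m)" by simp
    also have "\<dots> \<le> d" using card_supp_le_mon_deg[of m] f(2) m(1) by (simp add: homog_def)
    finally show "card (insert k (supp m)) - 1 \<le> d" .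
  qed
qed

text \<open>The monomial of an exchange cover with one vertex removed is a witness of degree
  \<open>card C - 1\<close>. It bounds the least degree and also makes the set under
  \<open>LEAST\<close> nonempty, so that the least degree is attained and yields an exchange cover
  in return.\<close>

lemma
  assumes G: "simple_graph V E" and C: "vertex_cover V E C" "exchange_property V E C"
  shows vnumber_le_exchange_cover:
      "vnumber V (cover_ideal V E :: ('v, 'k::field) mpoly set) \<le> card C - 1"
    and vnumber_attained_by_exchange_cover:
      "\<exists>D. vertex_cover V E D \<and> exchange_property V E D
        \<and> card D - 1 \<le> vnumber V (cover_ideal V E :: ('v, 'k) mpoly set)"
proof -
  let ?R = "polyring V :: ('v, 'k) mpoly set" and ?I = "cover_ideal V E :: ('v, 'k) mpoly set"
  let ?\<Phi> = "\<lambda>d. \<exists>f\<in>?R. homog d f \<and> (\<exists>P\<in>Ass ?R ?I. colon ?R ?I f = P)"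
  have V: "finite V" using G by (simp add: simple_graph_def)
  obtain k l where kl: "{k, l} \<in> E" "k \<in> C" "l \<notin> C" "vertex_cover V E ((C - {k}) \<union> {l})"
    using C(2) unfolding exchange_property_def by blast
  have CV: "C \<subseteq> V" "finite C" using C(1) V finite_subset by (auto simp: vertex_cover_def)
  let ?f = "xprod (C - {k}) :: ('v, 'k) mpoly"
  have "?f \<in> ?R" using CV by (intro polyring_xprod) auto
  moreover have "homog (card C - 1) ?f"
    using CV kl(2) by (simp add: homog_def mon_deg_sqfree_mon)
  moreover have "colon ?R ?I ?f = var_ideal V {k, l}"
    using colon_exchange_cover[OF V C(1) kl] .
  ultimately have ex: "?\<Phi> (card C - 1)"
    unfolding Ass_def using prime_var_ideal[of V "{k, l}"] by blast
  then show "vnumber V ?I \<le> card C - 1" unfolding vnumber_def by (rule Least_le)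
  from ex have "?\<Phi> (vnumber V ?I)" unfolding vnumber_def by (rule LeastI)
  then obtain f where "f \<in> ?R" "homog (vnumber V ?I) f" "prime_in ?R (colon ?R ?I f)"
    unfolding Ass_def by fastforce
  then show "\<exists>D. vertex_cover V E D \<and> exchange_property V E D \<and> card D - 1 \<le> vnumber V ?I"
    using colon_prime_imp_exchange_cover[OF G] by metis
qed

text \<open>Removing one end of an edge from \<open>V\<close> leaves an exchange cover with
  \<open>s - 1\<close> vertices, where \<open>s\<close> is \<open>card V\<close>, and no exchange
  cover is larger. Hence the v-number is at most \<open>s - 2\<close>, and it is smaller exactly
  when a smaller exchange cover exists.\<close>

lemma vnumber_eq_iff_exchange_covers:
  assumes G: "simple_graph V E" and "E \<noteq> {}"
  shows "vnumber V (cover_ideal V E :: ('v, 'k::field) mpoly set) = card V - 2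
    \<longleftrightarrow> (\<forall>C. vertex_cover V E C \<and> exchange_property V E C \<longrightarrow> card C = card V - 1)"
    (is "?v = _ \<longleftrightarrow> ?c")
proof -
  have V: "finite V" using G by (simp add: simple_graph_def)
  obtain k l where kl: "{k, l} \<in> E" "k \<noteq> l" "k \<in> V" "l \<in> V"
    using assms(2) by (metis G equals0I simple_graph_edgeE)
  have "e \<inter> (V - {v}) \<noteq> {}" if "e \<in> E" for e v
  proof -
    obtain x y where "e = {x, y}" "x \<noteq> y" "x \<in> V" "y \<in> V"
      using simple_graph_edgeE[OF G \<open>e \<in> E\<close>] .
    then show ?thesis by (cases "x = v") auto
  qed
  then have cov: "vertex_cover V E (V - {v})" for v
    by (auto simp: vertex_cover_def)
  have "V - {l} - {k} \<union> {l} = V - {k}" using kl by auto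
  then have "vertex_cover V E (V - {l} - {k} \<union> {l})" using cov[of k] by (simp only:)
  then have ex: "exchange_property V E (V - {l})"
    unfolding exchange_property_def using kl by blast
  \<comment> \<open>The lower bound keeps the truncated difference \<open>card C - 1\<close> from
    identifying an empty cover with a cover of one vertex.\<close>
  have card_le: "1 \<le> card C \<and> card C \<le> card V - 1" if C: "vertex_cover V E C" "exchange_property V E C" for C
  proof -
    obtain k l where "{k, l} \<in> E" "k \<in> C" "l \<notin> C" using C unfolding exchange_property_def by blast
    moreover have "C \<subseteq> V" "finite C" using C V finite_subset by (auto simp: vertex_cover_def)
    moreover have "l \<in> V" using simple_graph_edge_in[OF G \<open>{k, l} \<in> E\<close>] by blast
    ultimately have "C \<subset> V" "card C \<noteq> 0" by auto
    then show ?thesis using psubset_card_mono[OF V, of C] by linarith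
  qed
  have "card (V - {l}) = card V - 1" using kl V by simp
  then have le: "?v \<le> card V - 2"
    using vnumber_le_exchange_cover[OF G cov ex, where 'k='k] by simp
  show ?thesis
  proof
    assume v: "?v = card V - 2"
    show ?c
    proof (intro allI impI)
      fix C assume "vertex_cover V E C \<and> exchange_property V E C"
      then show "card C = card V - 1"
        using vnumber_le_exchange_cover[OF G, of C, where 'k='k] card_le[of C] v by linarith
    qed
  next
    assume ?c
    obtain D where "vertex_cover V E D" "exchange_property V E D" "card D - 1 \<le> ?v"
      using vnumber_attained_by_exchange_cover[OF G cov ex, where 'k='k] by blast
    moreover from this \<open>?c\<close> have "card D = card V - 1" by blast
    ultimately show "?v = card V - 2" using le by linarith
  qed
qed

section \<open>Graphs with transitive non-adjacency\<close>

text \<open>In a simple graph non-adjacency is reflexive and symmetric, so this makes it an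
  equivalence relation. It is the pivot through which the combinatorial conditions are
  compared.\<close>

definition nonadj_trans :: "'v set \<Rightarrow> 'v set set \<Rightarrow> bool" where
  "nonadj_trans V E \<longleftrightarrow>
    (\<forall>x\<in>V. \<forall>y\<in>V. \<forall>z\<in>V. {x, y} \<notin> E \<longrightarrow> {y, z} \<notin> E \<longrightarrow> {x, z} \<notin> E)"

lemma nonadj_transD:
  "nonadj_trans V E \<Longrightarrow> x \<in> V \<Longrightarrow> y \<in> V \<Longrightarrow> z \<in> V \<Longrightarrow> {x, y} \<notin> E \<Longrightarrow> {y, z} \<notin> E
    \<Longrightarrow> {x, z} \<notin> E"
  unfolding nonadj_trans_def by blast

text \<open>The failure is an induced subgraph made of the edge \<open>{x, z}\<close> and the
  isolated vertex \<open>y\<close>, a single obstruction used both for covers and for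
  connectedness.\<close>

lemma not_nonadj_transE:
  assumes "simple_graph V E" "\<not> nonadj_trans V E"
  obtains x y z where "x \<in> V" "y \<in> V" "z \<in> V" "x \<noteq> y" "y \<noteq> z" "x \<noteq> z"
    "{x, y} \<notin> E" "{y, z} \<notin> E" "{x, z} \<in> E"
proof -
  from assms(2) obtain x y z where xyz: "x \<in> V" "y \<in> V" "z \<in> V" "{x, y} \<notin> E" "{y, z} \<notin> E" "{x, z} \<in> E"
    unfolding nonadj_trans_def by blast
  moreover have "x \<noteq> z" using simple_graph_edge_in[OF assms(1) xyz(6)] by blast
  moreover have "x \<noteq> y" "y \<noteq> z" using xyz by auto
  ultimately show ?thesis using that by blast
qed

lemma induced_edges_self: "simple_graph V E \<Longrightarrow> induced_edges E V = E"
  by (auto simp: induced_edges_def elim: simple_graph_edgeE)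

lemma in_induced_edges: "x \<in> U \<Longrightarrow> y \<in> U \<Longrightarrow> {x, y} \<in> induced_edges E U \<longleftrightarrow> {x, y} \<in> E"
  by (simp add: induced_edges_def)

lemma simple_graph_induced:
  assumes "simple_graph V E" "U \<subseteq> V"
  shows "simple_graph U (induced_edges E U)"
  unfolding simple_graph_def
proof (intro conjI ballI)
  show "finite U" using assms finite_subset by (auto simp: simple_graph_def)
  fix e assume "e \<in> induced_edges E U"
  then have "e \<in> E" "e \<subseteq> U" by (auto simp: induced_edges_def)
  then show "\<exists>x y. x \<noteq> y \<and> x \<in> U \<and> y \<in> U \<and> e = {x, y}"
    using simple_graph_edgeE[OF assms(1)] by (metis insert_subset)
qed

lemma nonadj_trans_induced:
  assumes "nonadj_trans V E" "U \<subseteq> V"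
  shows "nonadj_trans U (induced_edges E U)"
  unfolding nonadj_trans_def
proof (intro ballI impI)
  fix x y z assume "x \<in> U" "y \<in> U" "z \<in> U" "{x, y} \<notin> induced_edges E U" "{y, z} \<notin> induced_edges E U"
  then show "{x, z} \<notin> induced_edges E U"
    using nonadj_transD[OF assms(1), of x y z] assms(2) by (auto simp: in_induced_edges)
qed

text \<open>For an edge \<open>{x, z}\<close> with common non-neighbour \<open>y\<close>, exchanging
  \<open>x\<close> for \<open>z\<close> turns the cover \<open>V - {y, z}\<close> into the cover
  \<open>V - {x, y}\<close>, which is too small. Conversely, when \<open>k\<close> is exchanged for
  \<open>l\<close>, a further vertex outside \<open>C\<close> would be adjacent to neither
  \<open>k\<close> nor \<open>l\<close>, contradicting transitivity.\<close>

lemma exchange_covers_iff_nonadj_trans: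
  assumes G: "simple_graph V E"
  shows "(\<forall>C. vertex_cover V E C \<and> exchange_property V E C \<longrightarrow> card C = card V - 1)
    \<longleftrightarrow> nonadj_trans V E"
proof
  have V: "finite V" using G by (simp add: simple_graph_def)
  assume c: "\<forall>C. vertex_cover V E C \<and> exchange_property V E C \<longrightarrow> card C = card V - 1"
  show "nonadj_trans V E"
  proof (rule ccontr)
    assume "\<not> nonadj_trans V E"
    then obtain x y z where xyz: "x \<in> V" "y \<in> V" "z \<in> V" "x \<noteq> y" "y \<noteq> z" "x \<noteq> z"
      "{x, y} \<notin> E" "{y, z} \<notin> E" "{x, z} \<in> E"
      using not_nonadj_transE[OF G] by metis
    have cov: "vertex_cover V E (V - {a, b})" if "{a, b} \<notin> E" for a b
      unfolding vertex_cover_def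
    proof (intro conjI ballI)
      fix e assume "e \<in> E"
      then obtain k l where "e = {k, l}" "k \<noteq> l" "k \<in> V" "l \<in> V" using simple_graph_edgeE[OF G] by metis
      then show "e \<inter> (V - {a, b}) \<noteq> {}" using that \<open>e \<in> E\<close> by (auto simp: insert_commute)
    qed auto
    have "V - {y, z} - {x} \<union> {z} = V - {x, y}" using xyz by auto
    then have "vertex_cover V E (V - {y, z} - {x} \<union> {z})" using cov[OF xyz(7)] by (simp only:)
    moreover have "x \<in> V - {y, z}" "z \<notin> V - {y, z}" using xyz by auto
    ultimately have "exchange_property V E (V - {y, z})"
      unfolding exchange_property_def using xyz(9) by blast
    then have "card (V - {y, z}) = card V - 1" using c cov[OF xyz(8)] by blast
    moreover have "card {x, y, z} \<le> card V" using xyz V by (intro card_mono) auto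
    moreover have "card (V - {y, z}) = card V - 2" using xyz V by (simp add: card_Diff_subset)
    ultimately show False using xyz by simp
  qed
next
  have V: "finite V" using G by (simp add: simple_graph_def)
  assume T: "nonadj_trans V E"
  show "\<forall>C. vertex_cover V E C \<and> exchange_property V E C \<longrightarrow> card C = card V - 1"
  proof (intro allI impI)
    fix C assume "vertex_cover V E C \<and> exchange_property V E C"
    then obtain k l where C: "vertex_cover V E C" "{k, l} \<in> E" "k \<in> C" "l \<notin> C"
      "vertex_cover V E (C - {k} \<union> {l})"
      unfolding exchange_property_def by blast
    have "y = l" if y: "y \<in> V" "y \<notin> C" for y
    proof (rule ccontr)
      assume "y \<noteq> l"
      have "{k, y} \<inter> (C - {k} \<union> {l}) = {}" "{y, l} \<inter> C = {}"
        using y C \<open>y \<noteq> l\<close> simple_graph_edge_in[OF G C(2)] by auto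
      then have "{k, y} \<notin> E" "{y, l} \<notin> E"
        using C(1,5) unfolding vertex_cover_def by blast+
      then show False
        using nonadj_transD[OF T _ y(1)] simple_graph_edge_in[OF G C(2)] C(2) by blast
    qed
    then have "C = V - {l}" using C(1,4) by (auto simp: vertex_cover_def)
    then show "card C = card V - 1" using simple_graph_edge_in[OF G C(2)] V by simp
  qed
qed

text \<open>The three-vertex obstruction is disconnected. Conversely, given an edge
  \<open>{k, l}\<close> of an induced subgraph, transitivity makes every vertex adjacent to
  \<open>k\<close> or to \<open>l\<close>, so every vertex reaches \<open>k\<close>.\<close>

lemma induced_connected_iff_nonadj_trans:
  assumes G: "simple_graph V E"
  shows "(\<forall>U. U \<subseteq> V \<and> induced_edges E U \<noteq> {} \<longrightarrow> graph_connected U (induced_edges E U))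
    \<longleftrightarrow> nonadj_trans V E"
proof
  assume e: "\<forall>U. U \<subseteq> V \<and> induced_edges E U \<noteq> {} \<longrightarrow> graph_connected U (induced_edges E U)"
  show "nonadj_trans V E"
  proof (rule ccontr)
    assume "\<not> nonadj_trans V E"
    then obtain x y z where xyz: "x \<in> V" "y \<in> V" "z \<in> V" "x \<noteq> y" "y \<noteq> z" "x \<noteq> z"
      "{x, y} \<notin> E" "{y, z} \<notin> E" "{x, z} \<in> E"
      using not_nonadj_transE[OF G] by metis
    let ?U = "{x, y, z}"
    have "{x, z} \<in> induced_edges E ?U" using xyz by (simp add: induced_edges_def)
    then have "induced_edges E ?U \<noteq> {}" by (metis empty_iff)
    moreover have "?U \<subseteq> V" using xyz(1-3) by simp
    ultimately have "graph_connected ?U (induced_edges E ?U)" using e by metis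
    then have "(\<lambda>a b. {a, b} \<in> induced_edges E ?U \<and> a \<in> ?U \<and> b \<in> ?U)\<^sup>*\<^sup>* y x"
      unfolding graph_connected_def by blast
    then show False
    proof (cases rule: converse_rtranclpE)
      case base
      then show ?thesis using xyz by simp
    next
      case (step w)
      then have "{y, w} \<in> E" "w \<in> ?U" by (auto simp: induced_edges_def)
      then show ?thesis
        using xyz simple_graph_edge_in(3)[OF G] by (auto simp: insert_commute)
    qed
  qed
next
  assume T: "nonadj_trans V E"
  show "\<forall>U. U \<subseteq> V \<and> induced_edges E U \<noteq> {} \<longrightarrow> graph_connected U (induced_edges E U)"
  proof (intro allI impI)
    fix U assume U: "U \<subseteq> V \<and> induced_edges E U \<noteq> {}"
    let ?E = "induced_edges E U"
    have G': "simple_graph U ?E" and T': "nonadj_trans U ?E"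
      using simple_graph_induced[OF G] nonadj_trans_induced[OF T] U by auto
    from U obtain e where "e \<in> ?E" by blast
    then obtain k l where kl: "{k, l} \<in> ?E" "k \<in> U" "l \<in> U" using simple_graph_edgeE[OF G'] by metis
    define r where "r = (\<lambda>a b. {a, b} \<in> ?E \<and> a \<in> U \<and> b \<in> U)"
    have sym: "r a b \<Longrightarrow> r b a" for a b by (auto simp: r_def insert_commute)
    have lk: "r l k" using kl by (auto simp: r_def insert_commute)
    have to_k: "r\<^sup>*\<^sup>* x k" if "x \<in> U" for x
    proof (cases "{x, k} \<in> ?E")
      case True
      then show ?thesis using that kl by (auto simp: r_def)
    next
      case False
      then have "{x, l} \<in> ?E"
        using nonadj_transD[OF T' kl(2) that kl(3)] kl(1) by (auto simp: insert_commute)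
      then have "r x l" using that kl by (simp add: r_def)
      with lk show ?thesis by (meson converse_rtranclp_into_rtranclp rtranclp.rtrancl_refl)
    qed
    have from_k: "r\<^sup>*\<^sup>* k x" if "x \<in> U" for x
    proof -
      have "symp r\<^sup>*\<^sup>*" by (intro symp_rtranclp sympI) (rule sym)
      then show ?thesis using to_k[OF that] by (rule sympD)
    qed
    have "r\<^sup>*\<^sup>* x y" if "x \<in> U" "y \<in> U" for x y
      using rtranclp_trans[OF to_k[OF that(1)] from_k[OF that(2)]] .
    then show "graph_connected U ?E" unfolding graph_connected_def r_def using kl by blast
  qed
qed

text \<open>The parts are the classes of non-adjacency, and an edge supplies two different classes.
  In the other direction disjointness makes the part of a vertex unique, so non-adjacency means
  lying in the same part.\<close>

lemma complete_multipartite_iff_nonadj_trans: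
  assumes G: "simple_graph V E" and "E \<noteq> {}"
  shows "complete_multipartite V E \<longleftrightarrow> nonadj_trans V E"
proof
  assume "complete_multipartite V E"
  then obtain P where P: "\<Union>P = V" "\<And>A B. A \<in> P \<Longrightarrow> B \<in> P \<Longrightarrow> A \<noteq> B \<Longrightarrow> A \<inter> B = {}"
    and E: "E = {{x, y} | x y. \<exists>A\<in>P. \<exists>B\<in>P. A \<noteq> B \<and> x \<in> A \<and> y \<in> B}"
    unfolding complete_multipartite_def by blast
  have iff: "{x, y} \<in> E \<longleftrightarrow> A \<noteq> B" if xy: "x \<in> A" "A \<in> P" "y \<in> B" "B \<in> P" for x y A B
  proof
    assume "{x, y} \<in> E"
    then obtain x' y' A' B' where *: "{x, y} = {x', y'}" "A' \<in> P" "B' \<in> P" "A' \<noteq> B'" "x' \<in> A'" "y' \<in> B'"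
      unfolding E by blast
    have "x' \<notin> B'" using P(2)[of A' B'] * by blast
    with * xy P(2)[of A A'] P(2)[of B B'] P(2)[of A B'] P(2)[of B A'] show "A \<noteq> B"
      unfolding doubleton_eq_iff by blast
  next
    assume "A \<noteq> B"
    then show "{x, y} \<in> E" unfolding E using xy by blast
  qed
  show "nonadj_trans V E"
    unfolding nonadj_trans_def
  proof (intro ballI impI)
    fix x y z assume xyz: "x \<in> V" "y \<in> V" "z \<in> V" and n: "{x, y} \<notin> E" "{y, z} \<notin> E"
    obtain A B C where "x \<in> A" "A \<in> P" "y \<in> B" "B \<in> P" "z \<in> C" "C \<in> P" using xyz P(1) by blast
    then show "{x, z} \<notin> E" using n iff by metis
  qed
next
  assume T: "nonadj_trans V E"
  have V: "finite V" using G by (simp add: simple_graph_def)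
  define r where "r = {(x, y). x \<in> V \<and> y \<in> V \<and> {x, y} \<notin> E}"
  have "equiv V r"
  proof (rule equivI)
    show "r \<subseteq> V \<times> V" by (auto simp: r_def)
    show "refl_on V r"
      using simple_graph_edge_in(3)[OF G, of x x for x] by (auto simp: refl_on_def r_def)
    show "sym r" by (auto simp: sym_def r_def insert_commute)
    show "trans r" using nonadj_transD[OF T] by (auto simp: trans_def r_def)
  qed
  have E_iff: "{x, y} \<in> E \<longleftrightarrow> x \<in> V \<and> y \<in> V \<and> (x, y) \<notin> r" for x y
    using simple_graph_edge_in[OF G] by (auto simp: r_def)
  obtain k l where kl: "{k, l} \<in> E" using assms(2) simple_graph_edgeE[OF G] by (metis equals0I)
  let ?P = "V // r"
  have "\<Union>?P = V" using Union_quotient[OF \<open>equiv V r\<close>] .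
  moreover have "{} \<notin> ?P" using in_quotient_imp_non_empty[OF \<open>equiv V r\<close>] by blast
  moreover have "\<forall>A\<in>?P. \<forall>B\<in>?P. A \<noteq> B \<longrightarrow> A \<inter> B = {}"
    using quotient_disj[OF \<open>equiv V r\<close>] by blast
  moreover have "card ?P \<ge> 2"
  proof -
    have "r `` {k} \<in> ?P" "r `` {l} \<in> ?P" "r `` {k} \<noteq> r `` {l}"
      using kl E_iff eq_equiv_class_iff[OF \<open>equiv V r\<close>] by (auto intro: quotientI)
    moreover have "finite ?P" using V by (auto simp: quotient_def)
    ultimately have "card {r `` {k}, r `` {l}} \<le> card ?P" by (intro card_mono) auto
    then show ?thesis using \<open>r `` {k} \<noteq> r `` {l}\<close> by simp
  qed
  moreover have "E = {{x, y} | x y. \<exists>A\<in>?P. \<exists>B\<in>?P. A \<noteq> B \<and> x \<in> A \<and> y \<in> B}"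
  proof -
    have iff: "{x, y} \<in> E \<longleftrightarrow> (\<exists>A\<in>?P. \<exists>B\<in>?P. A \<noteq> B \<and> x \<in> A \<and> y \<in> B)" for x y
    proof
      assume e: "{x, y} \<in> E"
      have "x \<in> r `` {x}" "y \<in> r `` {y}"
        using e E_iff equiv_class_self[OF \<open>equiv V r\<close>] by blast+
      moreover have "r `` {x} \<in> ?P" "r `` {y} \<in> ?P" "r `` {x} \<noteq> r `` {y}"
        using e E_iff eq_equiv_class_iff[OF \<open>equiv V r\<close>] by (auto intro: quotientI)
      ultimately show "\<exists>A\<in>?P. \<exists>B\<in>?P. A \<noteq> B \<and> x \<in> A \<and> y \<in> B" by metis
    next
      assume "\<exists>A\<in>?P. \<exists>B\<in>?P. A \<noteq> B \<and> x \<in> A \<and> y \<in> B"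
      then obtain A B where "A \<in> ?P" "B \<in> ?P" "A \<noteq> B" "x \<in> A" "y \<in> B" by blast
      then have "(x, y) \<notin> r" using quotient_eq_iff[OF \<open>equiv V r\<close>] by blast
      moreover have "x \<in> V" "y \<in> V"
        using \<open>A \<in> ?P\<close> \<open>B \<in> ?P\<close> \<open>x \<in> A\<close> \<open>y \<in> B\<close> in_quotient_imp_subset[OF \<open>equiv V r\<close>] by blast+
      ultimately show "{x, y} \<in> E" using E_iff by blast
    qed
    show ?thesis
    proof (rule set_eqI)
      fix e
      have "e \<in> E \<longleftrightarrow> (\<exists>x y. e = {x, y} \<and> {x, y} \<in> E)" using simple_graph_edgeE[OF G] by metis
      then show "e \<in> E \<longleftrightarrow> e \<in> {{x, y} | x y. \<exists>A\<in>?P. \<exists>B\<in>?P. A \<noteq> B \<and> x \<in> A \<and> y \<in> B}"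
        unfolding iff by blast
    qed
  qed
  ultimately show "complete_multipartite V E" unfolding complete_multipartite_def by blast
qed

text \<open>A path in the complement runs along non-edges, so by transitivity its ends are
  non-adjacent; hence the ends of an edge cannot be joined there.\<close>

lemma nonadj_trans_imp_codi_graph:
  assumes G: "simple_graph V E" and "E \<noteq> {}" and T: "nonadj_trans V E"
  shows "codi_graph V E"
  unfolding codi_graph_def
proof
  let ?r = "\<lambda>a b. {a, b} \<in> complement_edges V E \<and> a \<in> V \<and> b \<in> V"
  assume conn: "graph_connected V (complement_edges V E)"
  obtain k l where kl: "{k, l} \<in> E" using assms(2) simple_graph_edgeE[OF G] by (metis equals0I)
  have "?r\<^sup>*\<^sup>* k l"
    using conn simple_graph_edge_in[OF G kl] unfolding graph_connected_def by blast
  then have "{k, l} \<notin> E"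
  proof (induction rule: rtranclp_induct)
    case base
    then show ?case using simple_graph_edge_in(3)[OF G] by blast
  next
    case (step y z)
    then have "{y, z} \<notin> E" by (auto simp: complement_edges_def)
    then show ?case using step nonadj_transD[OF T, of k y z] simple_graph_edge_in[OF G kl] by blast
  qed
  then show False using kl by contradiction
qed

section \<open>Krull dimension\<close>

text \<open>A homogeneous system with more unknowns \<open>c i\<close> than equations; each step of
  Gaussian elimination removes one equation and one unknown.\<close>

lemma exists_linear_relation:
  fixes f :: "'i \<Rightarrow> 'b \<Rightarrow> 'k::field"
  assumes "finite B" "finite I" "card B < card I"
  shows "\<exists>c. (\<exists>i\<in>I. c i \<noteq> 0) \<and> (\<forall>b\<in>B. (\<Sum>i\<in>I. c i * f i b) = 0)"
  using assms
proof (induction B arbitrary: I f rule: finite_induct)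
  case empty
  then have "I \<noteq> {}" by auto
  then show ?case by (intro exI[of _ "\<lambda>_. 1"]) auto
next
  case (insert b B)
  show ?case
  proof (cases "\<forall>i\<in>I. f i b = 0")
    case True
    obtain c where "\<exists>i\<in>I. c i \<noteq> 0" "\<forall>b\<in>B. (\<Sum>i\<in>I. c i * f i b) = 0"
      using insert.IH[of I f] insert.prems insert.hyps by auto
    then show ?thesis using True by (intro exI[of _ c]) auto
  next
    case False
    then obtain j where j: "j \<in> I" "f j b \<noteq> 0" by blast
    define J where "J = I - {j}"
    have J: "finite J" "card B < card J" "j \<notin> J" "I = Set.insert j J"
      using insert.prems insert.hyps j by (auto simp: J_def)
    \<comment> \<open>\<open>g\<close> clears the entry at \<open>b\<close> using the pivot
      \<open>f j b\<close>. The coefficient that \<open>d\<close> gives to \<open>j\<close> collects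
      these corrections, so a relation among the \<open>g i\<close> becomes one among the
      \<open>f i\<close>.\<close>
    define g where "g i x = f i x - f i b / f j b * f j x" for i x
    obtain c where c: "\<exists>i\<in>J. c i \<noteq> 0" "\<forall>x\<in>B. (\<Sum>i\<in>J. c i * g i x) = 0"
      using insert.IH[OF J(1,2), of g] by blast
    define d where "d = c(j := - (\<Sum>i\<in>J. c i * (f i b / f j b)))"
    have dJ: "d i = c i" if "i \<in> J" for i using that J(3) by (auto simp: d_def)
    have "(\<Sum>i\<in>I. d i * f i x) = (\<Sum>i\<in>J. c i * g i x)" for x
    proof -
      have "(\<Sum>i\<in>I. d i * f i x) = d j * f j x + (\<Sum>i\<in>J. c i * f i x)"
        unfolding J(4) using J dJ by simp
      also have "\<dots> = (\<Sum>i\<in>J. c i * f i x) - (\<Sum>i\<in>J. c i * (f i b / f j b) * f j x)"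
        by (simp add: d_def sum_distrib_right)
      also have "\<dots> = (\<Sum>i\<in>J. c i * g i x)"
        unfolding sum_subtractf[symmetric]
        by (intro sum.cong refl) (simp add: g_def algebra_simps)
      finally show ?thesis .
    qed
    moreover have "g i b = 0" for i using j by (simp add: g_def)
    ultimately have "\<forall>x\<in>Set.insert b B. (\<Sum>i\<in>I. d i * f i x) = 0" using c(2) by simp
    moreover have "\<exists>i\<in>I. d i \<noteq> 0" using c(1) dJ J(4) by force
    ultimately show ?thesis by blast
  qed
qed

section \<open>Algebraic dependence by counting monomials\<close>

definition exponents :: "nat \<Rightarrow> nat \<Rightarrow> nat list set" where
  "exponents N n = {es. set es \<subseteq> {..<N} \<and> length es = n}"

lemma finite_exponents: "finite (exponents N n)"
  unfolding exponents_def by (rule finite_lists_length_eq) simp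

lemma card_exponents: "card (exponents N n) = N ^ n"
  unfolding exponents_def by (subst card_lists_length_eq) simp_all

lemma exponents_0: "exponents N 0 = {[]}"
  by (auto simp: exponents_def)

lemma sum_exponents_Suc:
  fixes g :: "nat list \<Rightarrow> 'a::comm_monoid_add"
  shows "(\<Sum>es\<in>exponents N (Suc n). g es) = (\<Sum>i<N. \<Sum>es\<in>exponents N n. g (i # es))"
proof -
  have "exponents N (Suc n) = (\<lambda>(i, es). i # es) ` ({..<N} \<times> exponents N n)"
  proof (rule set_eqI)
    fix xs
    show "xs \<in> exponents N (Suc n) \<longleftrightarrow> xs \<in> (\<lambda>(i, es). i # es) ` ({..<N} \<times> exponents N n)"
      by (cases xs) (auto simp: exponents_def)
  qed
  then have "(\<Sum>es\<in>exponents N (Suc n). g es)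
      = (\<Sum>p\<in>{..<N} \<times> exponents N n. g (case p of (i, es) \<Rightarrow> i # es))"
    by (simp add: sum.reindex inj_on_def o_def split_def)
  then show ?thesis by (simp add: sum.cartesian_product split_def)
qed

fun list_power :: "'a::comm_monoid_mult list \<Rightarrow> nat list \<Rightarrow> 'a" where
  "list_power (x # xs) (e # es) = x ^ e * list_power xs es"
| "list_power _ _ = 1"

abbreviation const :: "'k::field \<Rightarrow> ('v, 'k) mpoly" where
  "const c \<equiv> single 0 c"

lemma polyring_list_power:
  "set xs \<subseteq> polyring U \<Longrightarrow> list_power xs es \<in> polyring U"
  by (induction xs es rule: list_power.induct) (auto intro: polyring_intros)

lemma mon_deg_power_le:
  assumes "\<And>m. m \<in> supp x \<Longrightarrow> mon_deg m \<le> D"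
  shows "m \<in> supp ((x :: ('v, 'k::field) mpoly) ^ e) \<Longrightarrow> mon_deg m \<le> e * D"
proof (induction e arbitrary: m)
  case 0
  then show ?case by (simp add: mon_deg_def)
next
  case (Suc e)
  then obtain a b where "m = a + b" "a \<in> supp x" "b \<in> supp (x ^ e)"
    using keys_mult[of x "x ^ e"] by auto
  then show ?case using assms[of a] Suc.IH[of b] by (simp add: mon_deg_add)
qed

lemma mon_deg_list_power_le:
  fixes xs :: "('v, 'k::field) mpoly list"
  assumes "\<And>x m. x \<in> set xs \<Longrightarrow> m \<in> supp x \<Longrightarrow> mon_deg m \<le> D"
    and "m \<in> supp (list_power xs es)"
  shows "mon_deg m \<le> sum_list es * D"
  using assms
proof (induction xs es arbitrary: m rule: list_power.induct)
  case (1 x xs e es)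
  from "1.prems"(2) obtain a b where ab: "m = a + b" "a \<in> supp (x ^ e)" "b \<in> supp (list_power xs es)"
    using keys_mult[of "x ^ e" "list_power xs es"] by auto
  have "mon_deg a \<le> e * D" using "1.prems"(1) ab(2) by (intro mon_deg_power_le[of x]) auto
  moreover have "mon_deg b \<le> sum_list es * D" using "1.prems"(1) ab(3) by (intro "1.IH") auto
  ultimately show ?case using ab(1) by (simp add: mon_deg_add add_mult_distrib)
qed (simp_all add: mon_deg_def)

lemma sum_list_le_length_mult: "set es \<subseteq> {..<N} \<Longrightarrow> sum_list es \<le> length es * N"
  for N :: nat
  by (induction es) (auto simp: add_mono)

text \<open>Restricting the exponent function to \<open>U\<close> is injective on these monomials,
  so there are at most as many as maps from \<open>U\<close> to \<open>{..K}\<close>.\<close>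

lemma card_bounded_monomials:
  fixes U :: "'v set" and K :: nat
  assumes "finite U"
  defines "B \<equiv> {m :: 'v \<Rightarrow>\<^sub>0 nat. supp m \<subseteq> U \<and> (\<forall>v. coeff m v \<le> K)}"
  shows "finite B" "card B \<le> (K + 1) ^ card U"
proof -
  let ?h = "\<lambda>m. restrict (coeff m) U"
  have "inj_on ?h B"
  proof (intro inj_onI poly_mapping_eqI)
    fix m m' v assume "m \<in> B" "m' \<in> B" "?h m = ?h m'"
    then show "coeff m v = coeff m' v"
    proof (cases "v \<in> U")
      case True
      then show ?thesis using \<open>?h m = ?h m'\<close> by (metis restrict_apply')
    next
      case False
      then have "v \<notin> supp m" "v \<notin> supp m'" using \<open>m \<in> B\<close> \<open>m' \<in> B\<close> by (auto simp: B_def)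
      then show ?thesis by (simp add: not_in_keys_iff_lookup_eq_zero)
    qed
  qed
  moreover have "?h ` B \<subseteq> (\<Pi>\<^sub>E v\<in>U. {..K})" by (auto simp: B_def)
  moreover have "finite (\<Pi>\<^sub>E v\<in>U. {..K})" using assms(1) by (intro finite_PiE) auto
  ultimately have "finite B" "card B \<le> card (\<Pi>\<^sub>E v\<in>U. {..K})"
    by (rule inj_on_finite, rule card_inj_on_le)
  then show "finite B" "card B \<le> (K + 1) ^ card U"
    by (simp_all add: card_PiE[OF assms(1)])
qed

text \<open>The powers of the given polynomials with all exponents below \<open>N\<close> number \<open>N ^ length xs\<close>, and
  for large \<open>N\<close> this exceeds the number of monomials which can occur in them.\<close>

lemma algebraic_dependence:
  fixes xs :: "('v, 'k::field) mpoly list"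
  assumes U: "finite U" and xs: "set xs \<subseteq> polyring U" "card U < length xs"
  shows "\<exists>N c. (\<exists>es\<in>exponents N (length xs). c es \<noteq> 0)
    \<and> (\<Sum>es\<in>exponents N (length xs). const (c es) * list_power xs es) = 0"
proof -
  let ?n = "length xs" and ?u = "card U"
  \<comment> \<open>A crude common bound for the degrees of all terms of the given
    polynomials.\<close>
  define D where "D = (\<Sum>x\<in>set xs. \<Sum>m\<in>supp x. mon_deg m)"
  have D: "mon_deg m \<le> D" if "x \<in> set xs" "m \<in> supp x" for x m
  proof -
    have "mon_deg m \<le> (\<Sum>m\<in>supp x. mon_deg m)" using that by (intro member_le_sum) auto
    also have "\<dots> \<le> D" unfolding D_def
      using that by (intro member_le_sum[of x _ "\<lambda>x. \<Sum>m\<in>supp x. mon_deg m"]) auto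
    finally show ?thesis .
  qed
  \<comment> \<open>With \<open>n\<close> polynomials and \<open>u\<close> variables,
    \<open>N\<close> exceeds \<open>(n * D + 1) ^ u\<close>, and \<open>K\<close> bounds the degrees
    of all products considered. From \<open>K + 1 \<le> (n * D + 1) * N\<close> one gets
    \<open>(K + 1) ^ u < N ^ (u + 1) \<le> N ^ n\<close>, so there are more products than available
    monomials.\<close>
  define N where "N = (?n * D + 1) ^ ?u + 1"
  define K where "K = ?n * N * D"
  define B where "B = {m :: 'v \<Rightarrow>\<^sub>0 nat. supp m \<subseteq> U \<and> (\<forall>v. coeff m v \<le> K)}"
  have supp_B: "m \<in> B" if es: "es \<in> exponents N ?n" and m: "m \<in> supp (list_power xs es)" for es m
  proof -
    have "sum_list es \<le> length es * N"
      using sum_list_le_length_mult[of es N] es by (simp add: exponents_def)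
    then have "sum_list es * D \<le> K" using es by (simp add: K_def exponents_def mult_le_mono1)
    moreover have "mon_deg m \<le> sum_list es * D" using D m by (rule mon_deg_list_power_le)
    ultimately have "mon_deg m \<le> K" by linarith
    then have "coeff m v \<le> K" for v using coeff_le_mon_deg[of m v] by linarith
    moreover have "supp m \<subseteq> U"
      using polyring_list_power[OF xs(1), of es] m by (auto simp: polyring_def)
    ultimately show ?thesis by (simp add: B_def)
  qed
  have "card B \<le> (K + 1) ^ ?u" "finite B"
    unfolding B_def using card_bounded_monomials[OF U] by blast+
  moreover have "(K + 1) ^ ?u < N ^ ?n"
  proof -
    have "K + 1 \<le> (?n * D + 1) * N" by (simp add: K_def N_def algebra_simps)
    then have "(K + 1) ^ ?u \<le> (?n * D + 1) ^ ?u * N ^ ?u"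
      unfolding power_mult_distrib[symmetric] by (rule power_mono) simp
    also have "\<dots> < N * N ^ ?u" by (simp add: N_def)
    also have "\<dots> = N ^ Suc ?u" by simp
    also have "\<dots> \<le> N ^ ?n" using xs(2) by (intro power_increasing) (auto simp: N_def)
    finally show ?thesis .
  qed
  ultimately have "card B < card (exponents N ?n)" by (simp add: card_exponents)
  \<comment> \<open>One unknown for every exponent list and one equation for every monomial of
    \<open>B\<close>.\<close>
  then obtain c :: "nat list \<Rightarrow> 'k" where c: "\<exists>es\<in>exponents N ?n. c es \<noteq> 0"
    "\<forall>m\<in>B. (\<Sum>es\<in>exponents N ?n. c es * coeff (list_power xs es) m) = 0"
    using exists_linear_relation[OF \<open>finite B\<close> finite_exponents,
        where f = "\<lambda>es. coeff (list_power xs es)"]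
    by blast
  have coeff_const: "coeff (const a * f) m = a * coeff f m" for a and f :: "('v, 'k) mpoly" and m
    using coeff_single_mult[of 0 a f m] by simp
  have "(\<Sum>es\<in>exponents N ?n. const (c es) * list_power xs es) = 0"
  proof (rule poly_mapping_eqI)
    fix m
    have "(\<Sum>es\<in>exponents N ?n. c es * coeff (list_power xs es) m) = 0"
    proof (cases "m \<in> B")
      case False
      then have "coeff (list_power xs es) m = 0" if "es \<in> exponents N ?n" for es
        using supp_B[OF that] by (auto simp: in_keys_iff)
      then show ?thesis by simp
    qed (use c(2) in blast)
    then show "coeff (\<Sum>es\<in>exponents N ?n. const (c es) * list_power xs es) m = coeff 0 m"
      by (simp add: lookup_sum coeff_const)
  qed
  with c(1) show ?thesis by blast
qed

section \<open>Lengths of chains of primes\<close>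

lemma ideal_in_diff:
  assumes "ideal_in (polyring V) J" "a + b \<in> J" "b \<in> J"
  shows "a \<in> J"
proof -
  have "- 1 \<in> polyring V" by (intro polyring_intros)
  then have "(a + b) + (- 1) * b \<in> J" using assms unfolding ideal_in_def by blast
  then show ?thesis by simp
qed

lemma prime_in_power:
  assumes "prime_in (polyring V) P" "x \<in> polyring V" "x \<notin> P"
  shows "x ^ n \<notin> P"
proof (induction n)
  case 0
  then show ?case using prime_in_one[OF assms(1)] by simp
next
  case (Suc n)
  then show ?case
    using assms polyring_power[OF assms(2), of n] unfolding prime_in_def by auto
qed

text \<open>The elementary half of the Coquand--Lombardi criterion: dividing a relation modulo \<open>P 0\<close> by
  the largest power of the first element leaves, modulo \<open>P 1\<close>, a relation among the others.\<close>

lemma prime_chain_independent: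
  fixes xs :: "('v, 'k::field) mpoly list"
  assumes "set xs \<subseteq> polyring V"
    and "\<And>i. i \<le> length xs \<Longrightarrow> prime_in (polyring V) (P i)"
    and "\<And>i. i < length xs \<Longrightarrow> P i \<subseteq> P (Suc i) \<and> xs ! i \<in> P (Suc i) - P i"
    and "(\<Sum>es\<in>exponents N (length xs). const (c es) * list_power xs es) \<in> P 0"
    and "es \<in> exponents N (length xs)"
  shows "c es = 0"
  using assms
proof (induction xs arbitrary: P c es)
  case Nil
  show ?case
  proof (rule ccontr)
    assume "c es \<noteq> 0"
    have "prime_in (polyring V) (P 0)" using Nil by simp
    moreover have "const (c es) \<in> P 0" using Nil by (simp add: exponents_0)
    moreover have "const (inverse (c es)) \<in> polyring V" by (simp add: polyring_single)
    ultimately have "const (inverse (c es)) * const (c es) \<in> P 0"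
      unfolding prime_in_def ideal_in_def by blast
    then have "1 \<in> P 0" using \<open>c es \<noteq> 0\<close> by (simp add: mult_single)
    then show False using prime_in_one \<open>prime_in (polyring V) (P 0)\<close> by blast
  qed
next
  case (Cons x xs)
  let ?n = "length xs" and ?R = "polyring V :: ('v, 'k) mpoly set"
  \<comment> \<open>\<open>Q i\<close> is the coefficient of \<open>x ^ i\<close> when the relation
    is read as a polynomial in the first element.\<close>
  define Q where "Q i = (\<Sum>es\<in>exponents N ?n. const (c (i # es)) * list_power xs es)" for i
  have QR: "Q i \<in> ?R" for i
    unfolding Q_def using Cons.prems(1)
    by (intro polyring_sum polyring_mult polyring_single polyring_list_power) auto
  have P0: "prime_in ?R (P 0)" and P1: "prime_in ?R (P 1)"
    using Cons.prems(2)[of 0] Cons.prems(2)[of 1] by auto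
  have x: "x \<in> ?R" "x \<in> P 1" "x \<notin> P 0" "P 0 \<subseteq> P 1"
    using Cons.prems(1) Cons.prems(3)[of 0] by auto
  have sumQ: "(\<Sum>i<N. x ^ i * Q i) \<in> P 0"
    using Cons.prems(4) by (simp add: sum_exponents_Suc Q_def sum_distrib_left mult_ac)
  \<comment> \<open>Strong induction on the power of \<open>x\<close>: once the lower coefficients
    vanish, \<open>x ^ i\<close> factors out and \<open>Q i + x * S\<close> lies in
    \<open>P 0\<close>. As \<open>x\<close> lies in \<open>P 1\<close>, so does \<open>Q i\<close>,
    and the outer induction hypothesis applies to the chain starting at \<open>P 1\<close>.\<close>
  have zero: "i < N \<longrightarrow> (\<forall>es\<in>exponents N ?n. c (i # es) = 0)" for i
  proof (induction i rule: less_induct)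
    case (less i)
    show ?case
    proof
      assume "i < N"
      define S where "S = (\<Sum>j\<in>{Suc i..<N}. x ^ (j - Suc i) * Q j)"
      have SR: "S \<in> ?R" unfolding S_def using x QR by (intro polyring_intros)
      have "(\<Sum>j<N. x ^ j * Q j) = (\<Sum>j\<in>{i..<N}. x ^ j * Q j)"
        by (rule sum.mono_neutral_right) (use less in \<open>auto simp: Q_def\<close>)
      also have "\<dots> = x ^ i * Q i + (\<Sum>j\<in>{Suc i..<N}. x ^ j * Q j)"
        using \<open>i < N\<close> by (simp add: sum.atLeast_Suc_lessThan)
      also have "(\<Sum>j\<in>{Suc i..<N}. x ^ j * Q j)
          = (\<Sum>j\<in>{Suc i..<N}. x ^ i * (x * (x ^ (j - Suc i) * Q j)))"
      proof (rule sum.cong)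
        fix j assume "j \<in> {Suc i..<N}"
        then have "x ^ j = x ^ i * (x * x ^ (j - Suc i))"
          by (simp add: power_Suc[symmetric] power_add[symmetric] del: power_Suc)
        then show "x ^ j * Q j = x ^ i * (x * (x ^ (j - Suc i) * Q j))" by (simp add: mult_ac)
      qed simp
      also have "x ^ i * Q i + \<dots> = x ^ i * (Q i + x * S)"
        by (simp add: S_def sum_distrib_left distrib_left)
      finally have "x ^ i * (Q i + x * S) \<in> P 0" using sumQ by simp
      moreover have "x ^ i \<notin> P 0" using prime_in_power[OF P0 x(1,3)] .
      moreover have "x ^ i \<in> ?R" "Q i + x * S \<in> ?R" using x(1) QR SR by (auto intro: polyring_intros)
      ultimately have "Q i + x * S \<in> P 1" using P0 x(4) unfolding prime_in_def by blast
      moreover have "x * S \<in> P 1"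
        using P1 x(2) SR unfolding prime_in_def ideal_in_def by (metis mult.commute)
      ultimately have "Q i \<in> P 1" using ideal_in_diff P1 unfolding prime_in_def by blast
      show "\<forall>es\<in>exponents N ?n. c (i # es) = 0"
      proof
        fix es assume "es \<in> exponents N ?n"
        then show "c (i # es) = 0"
          using Cons.prems(1) Cons.prems(2)[of "Suc i" for i] Cons.prems(3)[of "Suc i" for i]
            \<open>Q i \<in> P 1\<close>
          by (intro Cons.IH[of "\<lambda>j. P (Suc j)" "\<lambda>es. c (i # es)"]) (auto simp: Q_def)
      qed
    qed
  qed
  show ?case using Cons.prems(5) zero by (cases es) (auto simp: exponents_def)
qed

lemma var_ideal_subset:
  fixes J :: "('v, 'k::field) mpoly set"
  assumes J: "ideal_in (polyring V) J" and U: "\<And>v. v \<in> U \<Longrightarrow> var v \<in> J"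
  shows "var_ideal V U \<subseteq> J"
proof
  fix f :: "('v, 'k) mpoly" assume f: "f \<in> var_ideal V U"
  have "single m (coeff f m) \<in> J" if m: "m \<in> supp f" for m
  proof -
    obtain v where v: "v \<in> U" "v \<in> supp m" using f m by (auto simp: var_ideal_def)
    have "supp (m - sqfree_mon {v}) \<subseteq> V"
      using f m supp_monomial_minus[of m] by (fastforce simp: var_ideal_def polyring_def)
    then have "single (m - sqfree_mon {v}) (coeff f m) * var v \<in> J"
      using J U[OF v(1)] polyring_single unfolding ideal_in_def by blast
    moreover have "m - sqfree_mon {v} + sqfree_mon {v} = m"
      using monomial_eq_sqfree_mon_add[of "{v}" m] v by (simp add: add.commute[of "m - _"])
    then have "single (m - sqfree_mon {v}) (coeff f m) * var v = single m (coeff f m)"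
      by (simp add: var_def sqfree_mon_def mult_single)
    ultimately show ?thesis by simp
  qed
  then show "f \<in> J" using ideal_in_sum[OF J] sum_of_terms[of f] by metis
qed

text \<open>Witnesses of the strict inclusions can be chosen free of the variables of
  \<open>U\<close>. More than \<open>card (V - U)\<close> of them would be algebraically dependent,
  which independence along a chain of primes forbids.\<close>

lemma prime_chain_length_le:
  fixes P :: "nat \<Rightarrow> ('v, 'k::field) mpoly set"
  assumes V: "finite V"
    and P: "\<And>i. i \<le> n \<Longrightarrow> prime_in (polyring V) (P i)" "\<And>i. i < n \<Longrightarrow> P i \<subset> P (Suc i)"
    and U: "\<And>i v. i \<le> n \<Longrightarrow> v \<in> U \<Longrightarrow> var v \<in> P i"
  shows "n \<le> card (V - U)"
proof (rule ccontr)
  assume "\<not> n \<le> card (V - U)"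
  let ?R = "polyring V :: ('v, 'k) mpoly set"
  have id: "ideal_in ?R (P i)" if "i \<le> n" for i using P(1)[OF that] by (simp add: prime_in_def)
  have sub: "var_ideal V U \<subseteq> P i" if "i \<le> n" for i
    using that by (intro var_ideal_subset id U)
  have "\<exists>y. y \<in> polyring (V - U) \<and> y \<in> P (Suc i) - P i" if i: "i < n" for i
  proof -
    obtain x where x: "x \<in> P (Suc i)" "x \<notin> P i" using P(2)[OF i] by blast
    have xR: "x \<in> ?R" using x(1) id[of "Suc i"] i by (auto simp: ideal_in_def)
    \<comment> \<open>\<open>?z\<close> collects the terms involving a variable of \<open>U\<close>
      and lies in every member of the chain; hence \<open>?y\<close> separates \<open>P i\<close>
      from \<open>P (Suc i)\<close> just as \<open>x\<close> does.\<close>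
    let ?y = "restrict_terms (\<lambda>m. supp m \<inter> U = {}) x"
    let ?z = "restrict_terms (\<lambda>m. \<not> supp m \<inter> U = {}) x"
    have "?z \<in> var_ideal V U"
      using xR by (auto simp: var_ideal_def supp_restrict_terms polyring_restrict_terms)
    then have z: "?z \<in> P i" "?z \<in> P (Suc i)"
      using sub[of i] sub[of "Suc i"] i by auto
    have split: "x = ?y + ?z" by (rule restrict_terms_split)
    have "?y \<in> P (Suc i)"
      by (rule ideal_in_diff[OF id[of "Suc i"], of ?y ?z])
        (use x(1) z(2) i in \<open>simp_all add: split[symmetric]\<close>)
    moreover have "?y \<notin> P i"
      using id[of i] x(2) z(1) split i unfolding ideal_in_def by (metis less_imp_le)
    moreover have "?y \<in> polyring (V - U)"
      using xR by (auto simp: polyring_def supp_restrict_terms)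
    ultimately show ?thesis by blast
  qed
  then obtain y where y: "\<And>i. i < n \<Longrightarrow> y i \<in> polyring (V - U) \<and> y i \<in> P (Suc i) - P i" by metis
  let ?xs = "map y [0..<n]"
  have "set ?xs \<subseteq> polyring (V - U)" using y by auto
  then obtain N c where c: "\<exists>es\<in>exponents N (length ?xs). c es \<noteq> 0"
    "(\<Sum>es\<in>exponents N (length ?xs). const (c es) * list_power ?xs es) = 0"
    using algebraic_dependence[of "V - U" ?xs] V \<open>\<not> n \<le> card (V - U)\<close> by auto
  have "c es = 0" if "es \<in> exponents N (length ?xs)" for es
  proof (rule prime_chain_independent[where P = P and V = V and xs = ?xs])
    show "set ?xs \<subseteq> ?R" using \<open>set ?xs \<subseteq> polyring (V - U)\<close> polyring_mono[of "V - U" V] by blast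
    show "(\<Sum>es\<in>exponents N (length ?xs). const (c es) * list_power ?xs es) \<in> P 0"
      using c(2) id[of 0] by (simp add: ideal_in_def)
    show "P i \<subseteq> P (Suc i) \<and> ?xs ! i \<in> P (Suc i) - P i" if "i < length ?xs" for i
      using that y[of i] P(2)[of i] by auto
  qed (use P that in auto)
  then show False using c(1) by blast
qed

text \<open>Otherwise choose in every edge an end whose variable is outside \<open>P\<close>. The
  chosen vertices form a cover, so their product lies in \<open>P\<close> although no factor
  does.\<close>

lemma prime_contains_cover_ideal:
  assumes G: "simple_graph V E" and P: "prime_in (polyring V) P" "cover_ideal V E \<subseteq> P"
  shows "\<exists>e\<in>E. \<forall>v\<in>e. var v \<in> (P :: ('v, 'k::field) mpoly set)"
proof (rule ccontr)
  assume "\<not> ?thesis"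
  then obtain w where w: "\<And>e. e \<in> E \<Longrightarrow> w e \<in> e \<and> var (w e) \<notin> P" by metis
  have V: "finite V" using G by (simp add: simple_graph_def)
  have "e \<subseteq> V" if "e \<in> E" for e using simple_graph_edgeE[OF G that] by blast
  then have A: "w ` E \<subseteq> V" "finite (w ` E)" using w V finite_subset[of "w ` E" V] by blast+
  have "vertex_cover V E (w ` E)" unfolding vertex_cover_def using w A by blast
  then have "xprod (w ` E) \<in> P"
    using P(2) A by (auto simp: cover_ideal_eq[OF V] supp_sqfree_mon polyring_xprod)
  then show False using prime_in_xprod[OF P(1) A(2,1)] w by blast
qed

text \<open>The bottom prime of a chain, and with it every other member, contains both variables of
  some edge; this bounds the length by \<open>card V - 2\<close>. Equality comes from the ideal of
  the two variables of an edge by adjoining the remaining variables one at a time in the order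
  \<open>h\<close>.\<close>

lemma krull_dim_cover_ideal:
  assumes G: "simple_graph V E" and "E \<noteq> {}"
  shows "krull_dim_quot V (cover_ideal V E :: ('v, 'k::field) mpoly set) = enat (card V - 2)"
proof -
  let ?R = "polyring V :: ('v, 'k) mpoly set" and ?I = "cover_ideal V E :: ('v, 'k) mpoly set"
  let ?L = "{enat n | n. \<exists>c :: nat \<Rightarrow> ('v, 'k) mpoly set.
      (\<forall>i\<le>n. prime_in ?R (c i) \<and> ?I \<subseteq> c i) \<and> (\<forall>i<n. c i \<subset> c (Suc i))}"
  have V: "finite V" using G by (simp add: simple_graph_def)
  have card: "card (V - {k, l}) = card V - 2" if "{k, l} \<in> E" for k l
    using simple_graph_edge_in[OF G that] V by (simp add: card_Diff_subset)
  have "n \<le> card V - 2" if c: "\<forall>i\<le>n. prime_in ?R (c i) \<and> ?I \<subseteq> c i" "\<forall>i<n. c i \<subset> c (Suc i)" for n c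
  proof -
    obtain e where e: "e \<in> E" "\<And>v. v \<in> e \<Longrightarrow> var v \<in> c 0"
      using prime_contains_cover_ideal[OF G, of "c 0"] c(1) by blast
    have mono: "c 0 \<subseteq> c i" if "i \<le> n" for i
      using that by (induction i) (use c(2) in \<open>auto simp: Suc_le_eq\<close>)
    have "n \<le> card (V - e)"
      by (rule prime_chain_length_le[OF V, of n c]) (use c e(2) mono in blast)+
    moreover obtain k l where "e = {k, l}" using simple_graph_edgeE[OF G e(1)] by blast
    ultimately show ?thesis using card e(1) by simp
  qed
  then have "Sup ?L \<le> enat (card V - 2)" by (intro Sup_least) auto
  moreover have "enat (card V - 2) \<in> ?L"
  proof -
    obtain k l where kl: "{k, l} \<in> E" using assms(2) simple_graph_edgeE[OF G] by (metis equals0I)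
    obtain h where h: "bij_betw h {0..<card V - 2} (V - {k, l})"
      using ex_bij_betw_nat_finite[of "V - {k, l}"] V card[OF kl] by auto
    let ?U = "\<lambda>i. {k, l} \<union> h ` {0..<i}"
    let ?c = "\<lambda>i. var_ideal V (?U i) :: ('v, 'k) mpoly set"
    have I: "?I \<subseteq> ?c i" for i
    proof -
      have "C \<inter> ?U i \<noteq> {}" if "vertex_cover V E C" for C
        using that kl unfolding vertex_cover_def by blast
      then show ?thesis by (auto simp: cover_ideal_eq[OF V] var_ideal_def)
    qed
    have strict: "?c i \<subset> ?c (Suc i)" if i: "i < card V - 2" for i
    proof
      show "?c i \<subseteq> ?c (Suc i)" by (force simp: var_ideal_def)
      have "h i \<in> V - {k, l}" using bij_betw_apply[OF h] i by simp
      moreover have "h i \<notin> h ` {0..<i}"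
        using inj_on_image_mem_iff[OF bij_betw_imp_inj_on[OF h], of i "{0..<i}"] i by auto
      ultimately have hi: "h i \<in> V" "h i \<notin> {k, l}" "h i \<notin> h ` {0..<i}" by auto
      then have "var (h i) \<in> ?c (Suc i)" "var (h i) \<notin> ?c i"
        by (auto simp: var_ideal_def polyring_var) (auto simp: var_def)
      then show "?c i \<noteq> ?c (Suc i)" by blast
    qed
    show ?thesis
      by (intro CollectI exI[of _ "card V - 2"] exI[of _ ?c] conjI allI impI refl prime_var_ideal I
          strict)
  qed
  then have "enat (card V - 2) \<le> Sup ?L" by (rule Sup_upper)
  ultimately show ?thesis unfolding krull_dim_quot_def by (rule antisym)
qed

section \<open>Regularity for complete multipartite graphs\<close>

text \<open>Zero passes vacuously and any term of a nonzero polynomial forces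
  \<open>d \<ge> 0\<close>, so the case distinction of the definition disappears.\<close>

lemma homog_int_iff: "homog_int d f \<longleftrightarrow> (\<forall>m\<in>supp f. int (mon_deg m) = d)"
proof (cases "f = 0")
  case False
  then obtain m where "m \<in> supp f" by (metis equals0I keys_eq_empty)
  then show ?thesis using False by (auto simp: homog_int_def homog_def)
qed (simp add: homog_int_def)

lemma homog_int_mult:
  assumes "homog_int d f" "homog_int e g"
  shows "homog_int (d + e) (f * g)"
  using assms keys_mult[of f g] by (fastforce simp: homog_int_iff mon_deg_add)

lemma homog_int_sum: "(\<And>i. i \<in> I \<Longrightarrow> homog_int d (f i)) \<Longrightarrow> homog_int d (sum f I)"
  using supp_sum_subset[of f I] unfolding homog_int_iff by blast

lemma homog_int_xprod: "finite A \<Longrightarrow> homog_int (int (card A)) (xprod A)"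
  by (simp add: homog_int_iff mon_deg_sqfree_mon)

text \<open>Only the partition behind a complete multipartite graph is kept; the sets
  \<open>V - p i\<close> are the minimal vertex covers of that graph.\<close>

locale vertex_partition =
  fixes V :: "'v set" and p :: "nat \<Rightarrow> 'v set" and k :: nat
  assumes finite_V: "finite V" and two_parts: "2 \<le> k"
    and union_parts: "(\<Union>i<k. p i) = V"
    and part_nonempty: "i < k \<Longrightarrow> p i \<noteq> {}"
    and parts_disjoint: "i < k \<Longrightarrow> j < k \<Longrightarrow> i \<noteq> j \<Longrightarrow> p i \<inter> p j = {}"
begin

definition copart_ideal :: "('v, 'k::field) mpoly set" where
  "copart_ideal = {f \<in> polyring V. \<forall>m\<in>supp f. \<exists>i<k. V - p i \<subseteq> supp m}"

section \<open>Generators over complements of parts and their syzygies\<close>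

lemma part_subset: "i < k \<Longrightarrow> p i \<subseteq> V"
  using union_parts by blast

lemma finite_part: "i < k \<Longrightarrow> finite (p i)"
  using part_subset finite_V finite_subset by blast

lemma card_copart: "i < k \<Longrightarrow> card (V - p i) + card (p i) = card V"
  using card_Diff_subset[OF finite_part part_subset] card_mono[OF finite_V part_subset] by simp

lemma xprod_copart_mult_part:
  "i < k \<Longrightarrow> xprod (V - p i) * xprod (p i) = (xprod V :: ('v, 'k::field) mpoly)"
  using xprod_mult_disjoint[of "V - p i" "p i"] finite_V finite_part[of i] part_subset[of i]
  by (simp add: Un_absorb2 Diff_disjoint Int_commute)

lemma copart_in: "xprod (V - p i) \<in> polyring V"
  using finite_V by (intro polyring_xprod) auto

lemma part_in: "i < k \<Longrightarrow> xprod (p i) \<in> polyring V"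
  using finite_part part_subset by (intro polyring_xprod) auto

lemma copart_ideal_iff:
  fixes f :: "('v, 'k::field) mpoly"
  shows "f \<in> copart_ideal
    \<longleftrightarrow> (\<exists>u. (\<forall>i<k. u i \<in> polyring V) \<and> f = (\<Sum>i<k. xprod (V - p i) * u i))"
proof
  assume "f \<in> copart_ideal"
  then have f: "f \<in> polyring V" "\<forall>m\<in>supp f. \<exists>i<k. V - p i \<subseteq> supp m"
    by (auto simp: copart_ideal_def)
  \<comment> \<open>\<open>h\<close> assigns to each term of \<open>f\<close> a generator dividing
    it; grouping the terms by \<open>h\<close> produces the cofactors.\<close>
  then obtain h where h: "\<And>m. m \<in> supp f \<Longrightarrow> h m < k \<and> V - p (h m) \<subseteq> supp m" by metis
  have "\<exists>u. u \<in> polyring V \<and> restrict_terms (\<lambda>m. h m = i) f = xprod (V - p i) * u" for i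
  proof -
    have "V - p i \<subseteq> supp m" if "m \<in> supp (restrict_terms (\<lambda>m. h m = i) f)" for m
      using that h by (auto simp: supp_restrict_terms)
    then show ?thesis
      using xprod_dvd[OF polyring_restrict_terms[OF f(1)], of "V - p i"] finite_V
      by (metis finite_Diff)
  qed
  then obtain u where u: "\<And>i. u i \<in> polyring V"
    "\<And>i. restrict_terms (\<lambda>m. h m = i) f = xprod (V - p i) * u i" by metis
  have "f = (\<Sum>i<k. restrict_terms (\<lambda>m. h m = i) f)"
  proof (rule poly_mapping_eqI)
    fix m
    have "coeff (\<Sum>i<k. restrict_terms (\<lambda>m. h m = i) f) m = (if h m < k then coeff f m else 0)"
      by (simp add: lookup_sum restrict_terms.rep_eq)
    also have "\<dots> = coeff f m" using h[of m] by (auto simp: in_keys_iff)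
    finally show "coeff f m = coeff (\<Sum>i<k. restrict_terms (\<lambda>m. h m = i) f) m" by simp
  qed
  then show "\<exists>u. (\<forall>i<k. u i \<in> polyring V) \<and> f = (\<Sum>i<k. xprod (V - p i) * u i)"
    using u by (intro exI[of _ u]) simp
next
  assume "\<exists>u. (\<forall>i<k. u i \<in> polyring V) \<and> f = (\<Sum>i<k. xprod (V - p i) * u i)"
  then obtain u where u: "\<forall>i<k. u i \<in> polyring V" and f: "f = (\<Sum>i<k. xprod (V - p i) * u i)"
    by blast
  have "f \<in> polyring V" unfolding f using u copart_in by (intro polyring_sum polyring_mult) auto
  moreover have "\<exists>i<k. V - p i \<subseteq> supp m" if "m \<in> supp f" for m
  proof -
    obtain i where "i < k" "m \<in> supp (xprod (V - p i) * u i)"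
      using \<open>m \<in> supp f\<close> supp_sum_subset[of "\<lambda>i. xprod (V - p i) * u i" "{..<k}"]
      unfolding f by blast
    then show ?thesis using supp_xprod_mult_superset[of "V - p i"] finite_V by blast
  qed
  ultimately show "f \<in> copart_ideal" by (simp add: copart_ideal_def)
qed

text \<open>A term of the \<open>i\<close>-th summand must be met by a term of another summand
  \<open>j\<close>, hence is divisible by all variables outside \<open>p j\<close>, among them those
  of \<open>p i\<close>. The generator \<open>xprod (V - p i)\<close> supplies none of the latter,
  so they divide the term of \<open>u i\<close>.\<close>

lemma copart_syzygy:
  fixes u :: "nat \<Rightarrow> ('v, 'k::field) mpoly"
  assumes u: "\<And>i. i < k \<Longrightarrow> u i \<in> polyring V" and zero: "(\<Sum>i<k. xprod (V - p i) * u i) = 0"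
    and i: "i < k"
  shows "\<exists>w\<in>polyring V. u i = xprod (p i) * w"
proof -
  have "p i \<subseteq> supp m" if m: "m \<in> supp (u i)" for m
  proof -
    let ?m = "sqfree_mon (V - p i) + m"
    have "xprod (V - p i) * u i + (\<Sum>j\<in>{..<k} - {i}. xprod (V - p j) * u j) = 0"
      using zero i by (simp add: sum.remove[of "{..<k}" i])
    from arg_cong[OF this, of "\<lambda>f. coeff f ?m"]
    have "coeff (xprod (V - p i) * u i) ?m
        + coeff (\<Sum>j\<in>{..<k} - {i}. xprod (V - p j) * u j) ?m = 0"
      by (simp only: lookup_add lookup_zero)
    then have "?m \<in> supp (\<Sum>j\<in>{..<k} - {i}. xprod (V - p j) * u j)"
      using m by (auto simp: in_keys_iff coeff_single_mult)
    then obtain j where j: "j < k" "j \<noteq> i" "?m \<in> supp (xprod (V - p j) * u j)"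
      using supp_sum_subset[of "\<lambda>j. xprod (V - p j) * u j" "{..<k} - {i}"] by blast
    have "V - p j \<subseteq> supp ?m" using supp_xprod_mult_superset[OF _ j(3)] finite_V by blast
    then have "V - p j \<subseteq> (V - p i) \<union> supp m"
      using finite_V by (simp add: supp_monomial_add supp_sqfree_mon)
    then show ?thesis using parts_disjoint[OF j(1) i j(2)] part_subset[OF i] by blast
  qed
  then show ?thesis using xprod_dvd[OF u[OF i] finite_part[OF i]] by metis
qed

section \<open>The explicit resolution of length two\<close>

definition res_rank :: "nat \<Rightarrow> nat" where
  "res_rank i = (if i = 0 then 1 else if i = 1 then k else k - 1)"

definition res_shift :: "nat \<Rightarrow> nat \<Rightarrow> int" where
  "res_shift i j = (if i = 0 then 0 else if i = 1 then int (card (V - p j)) else int (card V))"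

text \<open>A Hilbert-Burch resolution with ranks \<open>1\<close>, \<open>k\<close>,
  \<open>k - 1\<close>. Column \<open>j\<close> of the second matrix is the relation of generator
  \<open>Suc j\<close> with generator \<open>0\<close>, with entries
  \<open>xprod (p (Suc j))\<close> and \<open>- xprod (p 0)\<close>; both products give
  \<open>xprod V\<close>, which explains the shift \<open>card V\<close>.\<close>

definition res_map :: "nat \<Rightarrow> nat \<Rightarrow> nat \<Rightarrow> ('v, 'k::field) mpoly" where
  "res_map i r j = (if i = 1 then xprod (V - p j)
     else if r = 0 then - xprod (p 0) else if r = Suc j then xprod (p r) else 0)"

lemma app_res_map_1:
  "app_mat res_rank res_map 1 u = (\<lambda>r. if r = 0 then \<Sum>j<k. xprod (V - p j) * u j else 0)"
  by (rule ext) (simp add: app_mat_def res_rank_def res_map_def)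

lemma app_res_map_2:
  "app_mat res_rank res_map 2 w = (\<lambda>r. if r = 0 then - (xprod (p 0) * (\<Sum>j<k - 1. w j))
     else if r < k then xprod (p r) * w (r - 1) else 0)"
proof
  fix r
  consider "r = 0" | j where "r = Suc j" "r < k" | "r \<ge> k" "r \<noteq> 0"
    by (metis not_less not0_implies_Suc)
  then show "app_mat res_rank res_map 2 w r = (if r = 0 then - (xprod (p 0) * (\<Sum>j<k - 1. w j))
     else if r < k then xprod (p r) * w (r - 1) else 0)"
  proof cases
    case 1
    then show ?thesis
      using two_parts by (simp add: app_mat_def res_rank_def res_map_def sum_distrib_left sum_negf)
  next
    case (2 j)
    have "(\<Sum>l<k - 1. res_map 2 r l * w l) = (\<Sum>l<k - 1. if l = j then xprod (p r) * w l else 0)"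
      using 2 by (intro sum.cong refl) (auto simp: res_map_def)
    moreover have "j < k - 1" using 2 by linarith
    ultimately show ?thesis using 2 by (simp add: app_mat_def res_rank_def)
  next
    case 3
    then show ?thesis by (simp add: app_mat_def res_rank_def)
  qed
qed

lemma sum_parts_split: "(\<Sum>i<k. g i) = g 0 + (\<Sum>j<k - 1. g (Suc j))"
  using sum.lessThan_Suc_shift[of g "k - 1"] two_parts by simp

text \<open>Writing \<open>u i = xprod (p i) * w i\<close> turns the relation into
  \<open>xprod V\<close> times the sum of the \<open>w i\<close>. So \<open>w 0\<close> is minus the
  sum of the others, and these others are the coordinates with respect to the columns of the second
  matrix.\<close>

lemma copart_resolution_exact:
  shows "{u \<in> fvec (polyring V) k. app_mat res_rank res_map 1 u = (\<lambda>_. 0)}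
    = app_mat res_rank res_map 2 ` fvec (polyring V :: ('v, 'k::field) mpoly set) (k - 1)"
    (is "?K = ?M")
proof (intro set_eqI iffI)
  fix u :: "nat \<Rightarrow> ('v, 'k) mpoly" assume "u \<in> ?K"
  then have u: "\<And>i. i < k \<Longrightarrow> u i \<in> polyring V" "\<And>i. i \<ge> k \<Longrightarrow> u i = 0"
    and zero: "(\<Sum>i<k. xprod (V - p i) * u i) = 0"
    by (auto simp: fvec_def app_res_map_1 fun_eq_iff split: if_splits simp del: One_nat_def)
  have "\<forall>i. \<exists>w. i < k \<longrightarrow> w \<in> polyring V \<and> u i = xprod (p i) * w"
    using copart_syzygy[OF u(1) zero] by metis
  then obtain w where w: "\<And>i. i < k \<Longrightarrow> w i \<in> polyring V" "\<And>i. i < k \<Longrightarrow> u i = xprod (p i) * w i"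
    by metis
  have "xprod V * (\<Sum>i<k. w i) = (\<Sum>i<k. xprod (V - p i) * u i)"
    using w(2) by (simp add: sum_distrib_left mult.assoc[symmetric] xprod_copart_mult_part)
  then have "(\<Sum>i<k. w i) = 0" using zero single_mult_cancel[of "sqfree_mon V" _ 0] by simp
  then have w0: "w 0 = - (\<Sum>j<k - 1. w (Suc j))"
    using sum_parts_split[of w] by (simp add: eq_neg_iff_add_eq_0)
  define v where "v j = (if j < k - 1 then w (Suc j) else 0)" for j
  have "v \<in> fvec (polyring V) (k - 1)" using w(1) by (auto simp: fvec_def v_def)
  moreover have "u = app_mat res_rank res_map 2 v"
  proof
    fix r
    show "u r = app_mat res_rank res_map 2 v r"
    proof (cases "r = 0")
      case True
      then show ?thesis using w(2)[of 0] w0 two_parts by (simp add: app_res_map_2 v_def)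
    next
      case False
      then show ?thesis using w(2)[of r] u(2)[of r] by (auto simp: app_res_map_2 v_def)
    qed
  qed
  ultimately show "u \<in> ?M" by blast
next
  fix u :: "nat \<Rightarrow> ('v, 'k) mpoly" assume "u \<in> ?M"
  then obtain w where w: "w \<in> fvec (polyring V) (k - 1)" and u: "u = app_mat res_rank res_map 2 w"
    by blast
  have wR: "w j \<in> polyring V" for j using w by (cases "j < k - 1") (auto simp: fvec_def polyring_0)
  have "u i \<in> polyring V" if "i < k" for i
    using that wR part_in two_parts unfolding u app_res_map_2
    by (auto intro!: polyring_intros)
  moreover have "u i = 0" if "i \<ge> k" for i
    using that two_parts unfolding u app_res_map_2 by simp
  moreover have "(\<Sum>i<k. xprod (V - p i) * u i) = 0"
  proof -
    have "xprod (V - p 0) * u 0 = - (xprod V * (\<Sum>j<k - 1. w j))"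
      using two_parts xprod_copart_mult_part[of 0, where 'k='k]
      by (simp add: u app_res_map_2 mult.assoc[symmetric])
    moreover have "xprod (V - p (Suc j)) * u (Suc j) = xprod V * w j" if "j < k - 1" for j
    proof -
      have "Suc j < k" using that by simp
      then show ?thesis using xprod_copart_mult_part[of "Suc j", where 'k='k]
        by (simp add: u app_res_map_2 mult.assoc[symmetric])
    qed
    ultimately show ?thesis by (simp add: sum_parts_split sum_distrib_left)
  qed
  ultimately show "u \<in> ?K"
    by (simp add: fvec_def app_res_map_1 fun_eq_iff del: One_nat_def)
qed

lemma copart_resolution:
  "graded_free_res V (copart_ideal :: ('v, 'k::field) mpoly set) 2 res_rank res_shift res_map"
proof -
  let ?R = "polyring V :: ('v, 'k) mpoly set"
  have entries: "res_map i r j \<in> ?R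
      \<and> homog_int (res_shift i j - res_shift (i - 1) r) (res_map i r j :: ('v, 'k) mpoly)"
    if i: "i \<in> {1..2}" and r: "r < res_rank (i - 1)" and j: "j < res_rank i" for i r j
  proof (cases "i = 1")
    case True
    then show ?thesis
      using homog_int_xprod[of "V - p j"] finite_V copart_in
      by (auto simp: res_map_def res_shift_def)
  next
    case False
    then have "i = 2" using i by auto
    then have rk: "r < k" using r by (simp add: res_rank_def)
    have deg: "res_shift i j - res_shift (i - 1) r = int (card (p r))"
      using \<open>i = 2\<close> card_copart[OF rk] by (simp add: res_shift_def)
    have "homog_int (int (card (p r))) (xprod (p r) :: ('v, 'k) mpoly)"
      using homog_int_xprod finite_part[OF rk] by blast
    then have "homog_int (int (card (p r))) (res_map i r j :: ('v, 'k) mpoly)"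
      using \<open>i = 2\<close> by (auto simp: res_map_def homog_int_iff)
    moreover have "res_map i r j \<in> ?R"
      using \<open>i = 2\<close> part_in[OF rk] by (auto simp: res_map_def intro: polyring_intros)
    ultimately show ?thesis using deg by simp
  qed
  have image: "{app_mat res_rank res_map 1 u 0 | u. u \<in> fvec ?R (res_rank 1)} = copart_ideal"
    (is "?A = _")
  proof (intro set_eqI iffI)
    fix f assume "f \<in> ?A"
    then show "f \<in> copart_ideal"
      unfolding copart_ideal_iff by (auto simp: app_res_map_1 fvec_def res_rank_def simp del: One_nat_def)
  next
    fix f :: "('v, 'k) mpoly" assume "f \<in> copart_ideal"
    then obtain u where u: "\<forall>i<k. u i \<in> ?R" "f = (\<Sum>i<k. xprod (V - p i) * u i)"
      unfolding copart_ideal_iff by blast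
    define v where "v i = (if i < k then u i else 0)" for i
    have "v \<in> fvec ?R (res_rank 1)" using u by (simp add: v_def fvec_def res_rank_def)
    moreover have "f = app_mat res_rank res_map 1 v 0" using u by (simp add: app_res_map_1 v_def del: One_nat_def)
    ultimately show "f \<in> ?A" by blast
  qed
  \<comment> \<open>Row \<open>Suc j\<close> of the last matrix has the single nonzero entry
    \<open>xprod (p (Suc j))\<close>, so each coordinate is recovered by cancelling a
    monomial.\<close>
  have inj: "{u \<in> fvec ?R (res_rank 2). app_mat res_rank res_map 2 u = (\<lambda>_. 0)} = {\<lambda>_. 0}"
  proof (intro set_eqI iffI)
    fix u assume "u \<in> {u \<in> fvec ?R (res_rank 2). app_mat res_rank res_map 2 u = (\<lambda>_. 0)}"
    then have u: "u \<in> fvec ?R (k - 1)" "app_mat res_rank res_map 2 u = (\<lambda>_. 0)"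
      by (auto simp: res_rank_def)
    have "u j = 0" for j
    proof (cases "j < k - 1")
      case True
      then have "Suc j < k" by linarith
      then have "xprod (p (Suc j)) * u j = 0" using fun_cong[OF u(2), of "Suc j"]
        by (simp add: app_res_map_2)
      then show ?thesis using single_mult_cancel[of "sqfree_mon (p (Suc j))" "u j" 0] by simp
    next
      case False
      then show ?thesis using u(1) by (simp add: fvec_def)
    qed
    then show "u \<in> {\<lambda>_. 0}" by auto
  qed (auto simp: fvec_def polyring_0 app_res_map_2)
  have exact: "{u \<in> fvec ?R (res_rank i). app_mat res_rank res_map i u = (\<lambda>_. 0)}
      = app_mat res_rank res_map (Suc i) ` fvec ?R (res_rank (Suc i))" if "i \<in> {1..<2}" for i
  proof -
    have "i = 1" "Suc i = 2" using that by auto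
    then show ?thesis
      using copart_resolution_exact by (simp only:) (simp add: res_rank_def)
  qed
  show ?thesis
    unfolding graded_free_res_def Let_def
    using entries image inj exact by (simp add: res_rank_def res_shift_def)
qed

text \<open>Map the first two steps of an arbitrary resolution back to the generators
  \<open>xprod (V - p i)\<close>. These have no nonzero syzygies in degrees below \<open>card V\<close>, so if \<open>F\<^sub>2\<close> were
  generated in such degrees, every syzygy of \<open>F\<^sub>1\<close> would be sent to zero, including the one lifting
  \<open>p 1 e\<^sub>1 - p 0 e\<^sub>0\<close>.\<close>

lemma copart_resolution_shift_ge:
  fixes \<phi> :: "nat \<Rightarrow> nat \<Rightarrow> nat \<Rightarrow> ('v, 'k::field) mpoly"
  assumes res: "graded_free_res V copart_ideal n b a \<phi>"
  shows "n \<ge> 2 \<and> (\<exists>l<b 2. int (card V) \<le> a 2 l)"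
proof (rule ccontr)
  assume "\<not> ?thesis"
  then have small: "a 2 l < int (card V)" if "n \<ge> 2" "l < b 2" for l using that by force
  let ?R = "polyring V :: ('v, 'k) mpoly set"
  note conds = res[unfolded graded_free_res_def Let_def]
  note n = conjunct1[OF conds] and conds = conjunct2[OF conds]
  note b0 = conjunct1[OF conds] and conds = conjunct2[OF conds]
  note a0 = conjunct1[OF conds] and conds = conjunct2[OF conds]
  note entries = conjunct1[OF conds, rule_format] and conds = conjunct2[OF conds]
  note image = conjunct1[OF conds] and conds = conjunct2[OF conds]
  note exact = conjunct1[OF conds, rule_format] and inj = conjunct2[OF conds]
  define f where "f j = \<phi> 1 0 j" for j
  have app1: "app_mat b \<phi> 1 u = (\<lambda>r. if r = 0 then \<Sum>j<b 1. f j * u j else 0)" for u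
    by (rule ext) (simp add: app_mat_def b0 f_def)
  have unit: "(\<lambda>i. if i = j then 1 else 0) \<in> fvec ?R N" if "j < N" for j N
    using that by (auto simp: fvec_def polyring_0 polyring_1)
  have f_ideal: "f j \<in> copart_ideal" if "j < b 1" for j
  proof -
    let ?e = "\<lambda>i. if i = j then 1 else 0"
    have "f j = app_mat b \<phi> 1 ?e 0" using that
      by (simp add: app1 if_distrib[of "(*) x" for x] cong: if_cong del: One_nat_def)
    then have "f j \<in> {app_mat b \<phi> 1 u 0 | u. u \<in> fvec ?R (b 1)}"
      using unit[OF that] by (intro CollectI exI[of _ ?e] conjI)
    then show ?thesis unfolding image .
  qed
  \<comment> \<open>A column of a graded comparison map: it writes the generator \<open>f j\<close>
    of the ideal through the products \<open>xprod (V - p i)\<close> with coefficients of the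
    degrees dictated by the grading.\<close>
  define hlift where "hlift j d \<longleftrightarrow>
      (\<forall>i<k. d i \<in> ?R \<and> homog_int (a 1 j - int (card (V - p i))) (d i))
        \<and> f j = (\<Sum>i<k. xprod (V - p i) * d i)" for j d
  have "\<forall>j. \<exists>d. j < b 1 \<longrightarrow> hlift j d"
  proof
    fix j
    show "\<exists>d. j < b 1 \<longrightarrow> hlift j d"
    proof (cases "j < b 1")
      case True
      then obtain u where u: "\<forall>i<k. u i \<in> ?R" "f j = (\<Sum>i<k. xprod (V - p i) * u i)"
        using f_ideal copart_ideal_iff by blast
      \<comment> \<open>From each coefficient keep only the terms that multiply the generator into
        degree \<open>a 1 j\<close>; the rest contributes nothing because \<open>f j\<close> is
        homogeneous.\<close>
      let ?Q = "\<lambda>m. int (mon_deg m) = a 1 j"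
      let ?D = "\<lambda>i. restrict_terms (\<lambda>m. ?Q (sqfree_mon (V - p i) + m)) (u i)"
      have "homog_int (a 1 j) (f j)" using entries[of 1 0 j] n True by (simp add: f_def a0 b0)
      then have "f j = restrict_terms ?Q (f j)"
        by (intro restrict_terms_id[symmetric]) (simp add: homog_int_iff)
      also have "\<dots> = (\<Sum>i<k. xprod (V - p i) * ?D i)"
        by (simp add: u(2) restrict_terms_sum restrict_terms_single_mult)
      finally have "f j = (\<Sum>i<k. xprod (V - p i) * ?D i)" .
      moreover have "homog_int (a 1 j - int (card (V - p i))) (?D i)" for i
        using finite_V
        by (auto simp: homog_int_iff supp_restrict_terms mon_deg_add mon_deg_sqfree_mon)
      ultimately have "hlift j ?D"
        unfolding hlift_def using u(1) by (simp add: polyring_restrict_terms)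
      then show ?thesis by blast
    qed simp
  qed
  then have "\<exists>D. \<forall>j. j < b 1 \<longrightarrow> hlift j (D j)" by (rule choice)
  then obtain D where "\<forall>j. j < b 1 \<longrightarrow> hlift j (D j)" ..
  then have D: "\<And>i j. j < b 1 \<Longrightarrow> i < k \<Longrightarrow> D j i \<in> ?R"
    "\<And>i j. j < b 1 \<Longrightarrow> i < k \<Longrightarrow> homog_int (a 1 j - int (card (V - p i))) (D j i)"
    "\<And>j. j < b 1 \<Longrightarrow> f j = (\<Sum>i<k. xprod (V - p i) * D j i)"
    by (simp_all add: hlift_def)
  \<comment> \<open>The comparison map followed by the generators \<open>xprod (V - p i)\<close> is
    the first differential.\<close>
  have swap: "(\<Sum>i<k. xprod (V - p i) * (\<Sum>j<b 1. v j * D j i)) = (\<Sum>j<b 1. f j * v j)" for v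
  proof -
    have "(\<Sum>i<k. xprod (V - p i) * (\<Sum>j<b 1. v j * D j i))
        = (\<Sum>j<b 1. \<Sum>i<k. v j * (xprod (V - p i) * D j i))"
      by (subst sum.swap) (simp add: sum_distrib_left mult_ac)
    also have "\<dots> = (\<Sum>j<b 1. f j * v j)"
      using D(3) by (intro sum.cong refl) (simp add: sum_distrib_left[symmetric] mult.commute)
    finally show ?thesis .
  qed
  have vD: "(\<Sum>j<b 1. v j * D j i) \<in> ?R" if "\<And>j. j < b 1 \<Longrightarrow> v j \<in> ?R" "i < k" for v i
    using that D(1) by (intro polyring_sum polyring_mult) auto
  \<comment> \<open>All syzygies of the \<open>f j\<close> are sent to zero. For
    \<open>n = 1\<close> there is no nonzero syzygy; otherwise the columns of
    \<open>\<phi> 2\<close> generate them, and it is enough to treat each column.\<close>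
  have kill: "(\<Sum>j<b 1. v j * D j i) = 0"
    if v: "v \<in> fvec ?R (b 1)" and fv: "(\<Sum>j<b 1. f j * v j) = 0" and i: "i < k" for v i
  proof -
    have ker: "v \<in> {u \<in> fvec ?R (b 1). app_mat b \<phi> 1 u = (\<lambda>_. 0)}"
      using v fv by (simp add: app1 fun_eq_iff del: One_nat_def)
    show ?thesis
    proof (cases "n = 1")
      case True
      then have "v \<in> {\<lambda>_. 0}" using ker inj by (simp only:)
      then show ?thesis by simp
    next
      case False
      then have n2: "n \<ge> 2" "1 \<in> {1..<n}" using n by auto
      have ex: "{u \<in> fvec ?R (b 1). app_mat b \<phi> 1 u = (\<lambda>_. 0)} = app_mat b \<phi> 2 ` fvec ?R (b 2)"
        using exact[OF n2(2)] by (simp add: numeral_2_eq_2)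
      then obtain w where w: "v = app_mat b \<phi> 2 w" using ker by blast
      \<comment> \<open>The image of column \<open>l\<close> is a syzygy of total degree
        \<open>a 2 l\<close>, below \<open>card V\<close>. A nonzero coordinate would be divisible
        by \<open>xprod (p i)\<close>, which already forces total degree at least
        \<open>card V\<close>.\<close>
      have col: "(\<Sum>j<b 1. \<phi> 2 j l * D j i) = 0" if l: "l < b 2" for l
      proof (rule ccontr)
        let ?z = "\<lambda>i. \<Sum>j<b 1. \<phi> 2 j l * D j i"
        assume "?z i \<noteq> 0"
        then obtain m where m: "m \<in> supp (?z i)" by (metis equals0I keys_eq_empty)
        have \<phi>2: "\<phi> 2 j l \<in> ?R" "homog_int (a 2 l - a 1 j) (\<phi> 2 j l)" if "j < b 1" for j
          using entries[of 2 j l] that l n2 by auto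
        have "app_mat b \<phi> 2 (\<lambda>i. if i = l then 1 else 0) = (\<lambda>j. if j < b 1 then \<phi> 2 j l else 0)"
          using l by (simp add: app_mat_def fun_eq_iff if_distrib[of "(*) x" for x] cong: if_cong)
        then have "(\<lambda>j. if j < b 1 then \<phi> 2 j l else 0)
            \<in> {u \<in> fvec ?R (b 1). app_mat b \<phi> 1 u = (\<lambda>_. 0)}"
          unfolding ex using unit[OF l] by (rule image_eqI[OF sym])
        then have "app_mat b \<phi> 1 (\<lambda>j. if j < b 1 then \<phi> 2 j l else 0) 0 = 0" by simp
        then have "(\<Sum>j<b 1. f j * \<phi> 2 j l) = 0" by (simp add: app1 del: One_nat_def)
        then have "(\<Sum>i<k. xprod (V - p i) * ?z i) = 0" by (simp only: swap)
        from copart_syzygy[OF vD[OF \<phi>2(1)] this i]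
        obtain y where "?z i = xprod (p i) * y" by blast
        then have "p i \<subseteq> supp m" using m supp_xprod_mult_superset finite_part[OF i] by metis
        then have "card (p i) \<le> mon_deg m"
          using card_mono[of "supp m" "p i"] card_supp_le_mon_deg[of m] by simp
        moreover have "homog_int (a 2 l - int (card (V - p i))) (?z i)"
        proof (rule homog_int_sum)
          fix j assume "j \<in> {..<b 1}"
          then show "homog_int (a 2 l - int (card (V - p i))) (\<phi> 2 j l * D j i)"
            using homog_int_mult[OF \<phi>2(2) D(2), of j j i] i by simp
        qed
        then have "int (mon_deg m) = a 2 l - int (card (V - p i))" using m by (simp add: homog_int_iff)
        ultimately show False using small[OF n2(1) l] card_copart[OF i] by linarith
      qed
      have "(\<Sum>j<b 1. v j * D j i) = (\<Sum>j<b 1. \<Sum>l<b 2. w l * (\<phi> 2 j l * D j i))"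
        by (simp add: w app_mat_def sum_distrib_left mult_ac)
      also have "\<dots> = (\<Sum>l<b 2. w l * (\<Sum>j<b 1. \<phi> 2 j l * D j i))"
        by (subst sum.swap) (simp add: sum_distrib_left)
      finally show ?thesis using col by simp
    qed
  qed
  have k01: "0 < k" "1 < k" using two_parts by auto
  have "\<exists>c. c \<in> fvec ?R (b 1) \<and> xprod (V - p i) = (\<Sum>j<b 1. f j * c j)" if "i < k" for i
  proof -
    have "xprod (V - p i) \<in> (copart_ideal :: ('v, 'k) mpoly set)"
      using that copart_in finite_V by (auto simp: copart_ideal_def supp_sqfree_mon)
    then obtain c where "c \<in> fvec ?R (b 1)" "xprod (V - p i) = app_mat b \<phi> 1 c 0"
      using image by blast
    then show ?thesis by (auto simp: app1 simp del: One_nat_def)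
  qed
  then obtain c where c: "\<And>i. i < k \<Longrightarrow> c i \<in> fvec ?R (b 1)"
    "\<And>i. i < k \<Longrightarrow> xprod (V - p i) = (\<Sum>j<b 1. f j * c i j)"
    by metis
  \<comment> \<open>\<open>c i\<close> lifts the generator \<open>xprod (V - p i)\<close> to the
    first module of the resolution, so \<open>v\<close> lifts the relation between generators
    \<open>1\<close> and \<open>0\<close>. \<open>T i\<close> is coordinate \<open>1\<close> of the
    image of \<open>c i\<close> under the comparison map.\<close>
  define v where "v j = xprod (p 1) * c 1 j - xprod (p 0) * c 0 j" for j
  define T where "T i = (\<Sum>j<b 1. c i j * D j 1)" for i
  have "v \<in> fvec ?R (b 1)"
    unfolding fvec_def v_def
  proof (intro CollectI conjI allI impI)
    show "xprod (p 1) * c 1 j - xprod (p 0) * c 0 j \<in> ?R" if "j < b 1" for j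
      using c(1)[OF k01(1)] c(1)[OF k01(2)] that
      by (intro polyring_diff polyring_mult part_in k01) (auto simp: fvec_def)
    show "xprod (p 1) * c 1 j - xprod (p 0) * c 0 j = 0" if "j \<ge> b 1" for j
      using c(1)[OF k01(1)] c(1)[OF k01(2)] that by (simp add: fvec_def)
  qed
  moreover have "(\<Sum>j<b 1. f j * v j) = 0"
  proof -
    have "(\<Sum>j<b 1. f j * v j)
        = (\<Sum>j<b 1. f j * c 1 j) * xprod (p 1) - (\<Sum>j<b 1. f j * c 0 j) * xprod (p 0)"
      by (simp add: v_def sum_distrib_left sum_subtractf[symmetric] algebra_simps)
    also have "\<dots> = xprod (V - p 1) * xprod (p 1) - xprod (V - p 0) * xprod (p 0)"
      using c(2)[OF k01(1)] c(2)[OF k01(2)] by simp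
    finally show ?thesis
      using xprod_copart_mult_part[OF k01(1), where 'k='k]
        xprod_copart_mult_part[OF k01(2), where 'k='k] by simp
  qed
  ultimately have "(\<Sum>j<b 1. v j * D j 1) = 0" using kill k01(2) by blast
  moreover have "(\<Sum>j<b 1. v j * D j 1) = xprod (p 1) * T 1 - xprod (p 0) * T 0"
    by (simp add: v_def T_def sum_distrib_left sum_subtractf[symmetric] algebra_simps)
  ultimately have eq: "xprod (p 1) * T 1 = xprod (p 0) * T 0" by simp
  \<comment> \<open>Lifting generator \<open>1\<close> and mapping it back can change it only by a
    syzygy. Coordinate \<open>1\<close> of that syzygy is divisible by \<open>xprod (p 1)\<close>,
    so \<open>T 1\<close> has constant term one.\<close>
  let ?u = "\<lambda>i. (\<Sum>j<b 1. c 1 j * D j i) - (if i = 1 then 1 else 0)"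
  have "(\<Sum>i<k. xprod (V - p i) * ?u i) = (\<Sum>j<b 1. f j * c 1 j) - xprod (V - p 1)"
    using k01(2) by (simp add: right_diff_distrib sum_subtractf swap if_distrib[of "(*) x" for x]
        cong: if_cong del: One_nat_def)
  then have u0: "(\<Sum>i<k. xprod (V - p i) * ?u i) = 0" using c(2)[OF k01(2)] by simp
  have "?u i \<in> ?R" if "i < k" for i
    using vD[of "c 1" i] c(1)[OF k01(2)] that
    by (intro polyring_diff) (auto simp: fvec_def polyring_0 polyring_1)
  from copart_syzygy[OF this u0 k01(2)] obtain w where "?u 1 = xprod (p 1) * w" by blast
  then have T1: "T 1 = 1 + xprod (p 1) * w" by (simp add: T_def algebra_simps)
  have "\<not> p 1 \<subseteq> supp (0 :: 'v \<Rightarrow>\<^sub>0 nat)" using part_nonempty[OF k01(2)] by simp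
  then have "coeff (xprod (p 1) * w) 0 = 0"
    using supp_xprod_mult_superset finite_part[OF k01(2)] in_keys_iff by metis
  then have "coeff (T 1) 0 = 1" by (simp add: T1 lookup_add del: One_nat_def)
  \<comment> \<open>The monomial of \<open>p 1\<close> therefore occurs in a multiple of
    \<open>xprod (p 0)\<close>, which is impossible for disjoint nonempty parts.\<close>
  then have "coeff (xprod (p 1) * T 1) (sqfree_mon (p 1)) = 1"
    using coeff_single_mult[of "sqfree_mon (p 1)" 1 "T 1" 0] by simp
  then have "sqfree_mon (p 1) \<in> supp (xprod (p 0) * T 0)" by (simp add: eq[symmetric] in_keys_iff del: One_nat_def)
  then have "p 0 \<subseteq> p 1"
    using supp_xprod_mult_superset finite_part[OF k01(1)] supp_sqfree_mon[OF finite_part[OF k01(2)]]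
    by metis
  then show False using parts_disjoint[OF k01] part_nonempty[OF k01(1)] by auto
qed

section \<open>The value of the regularity\<close>

lemma card_V_ge_2: "2 \<le> card V"
proof -
  have "card (p 0) \<ge> 1" "card (V - p 0) \<ge> 1"
    using part_nonempty[of 0] part_nonempty[of 1] parts_disjoint[of 0 1] part_subset[of 1]
      finite_part[of 0] finite_V two_parts by (auto simp: Suc_le_eq card_gt_0_iff)
  then show ?thesis using card_copart[of 0] two_parts by simp
qed

text \<open>The explicit resolution contributes \<open>card V - 2\<close> in step two and no more
  before, since every part is nonempty. Any other resolution has a shift of at least
  \<open>card V\<close> in step two, so the minimum is attained.\<close>

lemma reg_copart_ideal:
  "reg_quot V (copart_ideal :: ('v, 'k::field) mpoly set) = int (card V - 2)"
  unfolding reg_quot_def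
proof (rule cInf_eq_minimum)
  have "res_shift i j - int i \<le> int (card V - 2)" if "i \<le> 2" "j < res_rank i" for i j
  proof -
    have "i = 0 \<or> i = 1 \<and> j < k \<or> i = 2"
      using \<open>i \<le> 2\<close> \<open>j < res_rank i\<close> by (auto simp: res_rank_def split: if_splits)
    then consider "i = 0" | "i = 1" "j < k" | "i = 2" by blast
    then show ?thesis
    proof cases
      case 2
      then have "card (p j) \<ge> 1"
        using part_nonempty finite_part by (auto simp: Suc_le_eq card_gt_0_iff)
      then show ?thesis using 2 card_copart[of j] card_V_ge_2 by (simp add: res_shift_def)
    qed (use card_V_ge_2 in \<open>auto simp: res_shift_def\<close>)
  qed
  then show "int (card V - 2) \<in> {r. \<exists>n b a \<phi>. graded_free_res V (copart_ideal :: ('v, 'k) mpoly set) n b a \<phi>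
      \<and> (\<forall>i\<le>n. \<forall>j<b i. a i j - int i \<le> r)}"
    using copart_resolution by blast
next
  fix r assume "r \<in> {r. \<exists>n b a \<phi>. graded_free_res V (copart_ideal :: ('v, 'k) mpoly set) n b a \<phi>
      \<and> (\<forall>i\<le>n. \<forall>j<b i. a i j - int i \<le> r)}"
  then obtain n b a and \<phi> :: "nat \<Rightarrow> nat \<Rightarrow> nat \<Rightarrow> ('v, 'k) mpoly"
    where res: "graded_free_res V copart_ideal n b a \<phi>" and r: "\<And>i j. i \<le> n \<Longrightarrow> j < b i \<Longrightarrow> a i j - int i \<le> r"
    by blast
  obtain l where "2 \<le> n" "l < b 2" "int (card V) \<le> a 2 l"
    using copart_resolution_shift_ge[OF res] by blast
  then show "int (card V - 2) \<le> r" using r[of 2 l] card_V_ge_2 by simp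
qed

end

text \<open>A subset of \<open>V\<close> is a cover exactly when all vertices it misses lie in one
  part, since two missed vertices of different parts span an uncovered edge. This identifies the
  ideal of covers with \<open>copart_ideal\<close>.\<close>

lemma reg_cover_ideal_complete_multipartite:
  assumes G: "simple_graph V E" and "complete_multipartite V E"
  shows "reg_quot V (cover_ideal V E :: ('v, 'k::field) mpoly set) = int (card V - 2)"
proof -
  obtain P where P: "\<Union>P = V" "{} \<notin> P" "\<And>A B. A \<in> P \<Longrightarrow> B \<in> P \<Longrightarrow> A \<noteq> B \<Longrightarrow> A \<inter> B = {}" "card P \<ge> 2"
    and E: "E = {{x, y} | x y. \<exists>A\<in>P. \<exists>B\<in>P. A \<noteq> B \<and> x \<in> A \<and> y \<in> B}"
    using assms(2) unfolding complete_multipartite_def by blast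
  have V: "finite V" using G by (simp add: simple_graph_def)
  have "finite P" using P(4) card.infinite by fastforce
  then obtain p where p: "bij_betw p {0..<card P} P" using ex_bij_betw_nat_finite by blast
  then have p_in: "p i \<in> P" if "i < card P" for i using that bij_betw_apply by fastforce
  have p_image: "P = p ` {..<card P}" using p by (auto simp: bij_betw_def atLeast0LessThan)
  interpret vertex_partition V p "card P"
  proof
    show "(\<Union>i<card P. p i) = V" using P(1) p_image by simp
    show "p i \<inter> p j = {}" if "i < card P" "j < card P" "i \<noteq> j" for i j
    proof -
      have "p i \<noteq> p j" using inj_onD[OF bij_betw_imp_inj_on[OF p], of i j] that by auto
      then show ?thesis using P(3) p_in that by blast
    qed
  qed (use V P(2,4) p_in in force)+
  have "vertex_cover V E C \<longleftrightarrow> (\<exists>i<card P. V - p i \<subseteq> C)" if C: "C \<subseteq> V" for C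
  proof
    assume cov: "vertex_cover V E C"
    show "\<exists>i<card P. V - p i \<subseteq> C"
    proof (cases "V - C = {}")
      \<comment> \<open>When nothing is missed any part will do, and part \<open>0\<close>
        exists.\<close>
      case True
      then show ?thesis using P(4) by (intro exI[of _ 0]) auto
    next
      case False
      then obtain x A where x: "x \<in> V - C" "x \<in> A" "A \<in> P" using P(1) by blast
      have "y \<in> A" if "y \<in> V" "y \<notin> C" for y
      proof (rule ccontr)
        assume "y \<notin> A"
        obtain B where "y \<in> B" "B \<in> P" using \<open>y \<in> V\<close> P(1) by blast
        then have "{x, y} \<in> E" unfolding E using x \<open>y \<notin> A\<close> by blast
        then have "{x, y} \<inter> C \<noteq> {}" 
          using conjunct2[OF cov[unfolded vertex_cover_def]] by (rule bspec[rotated])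
        then show False using x(1) \<open>y \<notin> C\<close> by blast
      qed
      moreover obtain i where "i < card P" "p i = A" using x(3) by (metis imageE lessThan_iff p_image)
      ultimately show ?thesis by blast
    qed
  next
    assume "\<exists>i<card P. V - p i \<subseteq> C"
    then obtain A where A: "A \<in> P" "V - A \<subseteq> C" using p_in by blast
    have "e \<inter> C \<noteq> {}" if e_in: "e \<in> E" for e
    proof -
      obtain x y B B' where e: "e = {x, y}" "B \<in> P" "B' \<in> P" "B \<noteq> B'" "x \<in> B" "y \<in> B'"
        using e_in unfolding E by blast
      then have "x \<in> V" "y \<in> V" "x \<notin> A \<or> y \<notin> A" using P(1) P(3)[of B A] P(3)[of B' A] A(1) by blast+
      then show ?thesis using A(2) e(1) by blast
    qed
    then show "vertex_cover V E C" using C by (simp add: vertex_cover_def)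
  qed
  then have "(cover_ideal V E :: ('v, 'k) mpoly set) = copart_ideal"
    unfolding cover_ideal_eq[OF V] copart_ideal_def polyring_def by auto
  then show ?thesis using reg_copart_ideal by simp
qed

section \<open>The equivalences\<close>

theorem theorem3p10:
  fixes V :: "'v set" and E :: "'v set set"
  assumes "simple_graph V E" and "E \<noteq> {}"
  defines "s \<equiv> card V"
  defines "Ic \<equiv> (cover_ideal V E :: ('v,'k::field) mpoly set)"
  shows
   "(vnumber V Ic = s - 2 \<longleftrightarrow>
       vnumber V Ic = s - 2 \<and> reg_quot V Ic = int (s - 2) \<and>
       krull_dim_quot V Ic = enat (s - 2) \<and> codi_graph V E)
    \<and> (vnumber V Ic = s - 2 \<longleftrightarrow>
       (\<forall>C. vertex_cover V E C \<and> exchange_property V E C \<longrightarrow> card C = s - 1))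
    \<and> (vnumber V Ic = s - 2 \<longleftrightarrow>
       (\<forall>U. U \<subseteq> V \<and> induced_edges E U \<noteq> {} \<longrightarrow>
          vnumber U (cover_ideal U (induced_edges E U) :: ('v,'k) mpoly set) = card U - 2))
    \<and> (vnumber V Ic = s - 2 \<longleftrightarrow>
       (\<forall>U. U \<subseteq> V \<and> induced_edges E U \<noteq> {} \<longrightarrow> graph_connected U (induced_edges E U)))
    \<and> (vnumber V Ic = s - 2 \<longleftrightarrow> complete_multipartite V E)"
proof -
  have G: "simple_graph V E" and "E \<noteq> {}" by fact+
  note c_iff = exchange_covers_iff_nonadj_trans[OF G]
    and e_iff = induced_connected_iff_nonadj_trans[OF G]
    and f_iff = complete_multipartite_iff_nonadj_trans[OF G \<open>E \<noteq> {}\<close>]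
  \<comment> \<open>Formulated for an arbitrary graph with an edge, so that it applies to
    \<open>G\<close> and to each induced subgraph in condition (d).\<close>
  have v_iff: "vnumber U (cover_ideal U F :: ('v,'k) mpoly set) = card U - 2 \<longleftrightarrow> nonadj_trans U F"
    if "simple_graph U F" "F \<noteq> {}" for U :: "'v set" and F
    using vnumber_eq_iff_exchange_covers[OF that, where 'k='k]
      exchange_covers_iff_nonadj_trans[OF that(1)] by simp
  have a_iff: "vnumber V Ic = s - 2 \<longleftrightarrow> nonadj_trans V E"
    unfolding Ic_def s_def using v_iff[OF G \<open>E \<noteq> {}\<close>] .
  have "reg_quot V Ic = int (s - 2) \<and> krull_dim_quot V Ic = enat (s - 2) \<and> codi_graph V E"
    if "nonadj_trans V E"
    unfolding Ic_def s_def
    using reg_cover_ideal_complete_multipartite[OF G] f_iff that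
      krull_dim_cover_ideal[OF G \<open>E \<noteq> {}\<close>] nonadj_trans_imp_codi_graph[OF G \<open>E \<noteq> {}\<close>]
    by blast
  moreover have "(\<forall>U. U \<subseteq> V \<and> induced_edges E U \<noteq> {} \<longrightarrow>
      vnumber U (cover_ideal U (induced_edges E U) :: ('v,'k) mpoly set) = card U - 2)
    \<longleftrightarrow> nonadj_trans V E" (is "?d \<longleftrightarrow> _")
  proof
    \<comment> \<open>The graph is an induced subgraph of itself, on \<open>U = V\<close>.\<close>
    assume ?d
    then show "nonadj_trans V E"
      using v_iff[OF G \<open>E \<noteq> {}\<close>] induced_edges_self[OF G] \<open>E \<noteq> {}\<close> by (metis order_refl)
  next
    assume "nonadj_trans V E"
    then show ?d
      using v_iff simple_graph_induced[OF G] nonadj_trans_induced by blast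
  qed
  ultimately show ?thesis
    unfolding a_iff e_iff f_iff using c_iff unfolding s_def by blast
qed

end
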